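(* Let $\Gamma$ be a subgroup of the group $\mathrm{Isom}^+(\mathbb{D})$ of orientation preserving isometries of $\mathbb{D}$, and let $\mathfrak{g}$ be the Lie algebra of $\mathrm{Isom}^+(\mathbb{D})$, i.e. the space of Killing vector fields on $\mathbb{D}$. Let $q=f\,dz^2$ be a holomorphic quadratic differential on $\mathbb{D}$ such that $q$ is bounded in the hyperbolic metric $\mathbf{g}_{\mathbb{D}}$ and the first and second covariant derivatives of $q$ with respect to the linear connection on $T^*\mathbb{D}\otimes_{\mathbb{C}}T^*\mathbb{D}$ are bounded in $\mathbf{g}_{\mathbb{D}}$. Let $\chi$ be a harmonic vector field on $\mathbb{D}$ with $(\mathcal{L}_\chi\mathbf{g}_{\mathbb{D}})^{(2,0)}=q$ which admits an $L^2$-extension to $\overline{\mathbb{D}}$ whose restriction to $\mathbb{S}^1$ is tangential. If in addition $q$ is $\Gamma$-invariant, i.e. $$f(\gamma(z))\gamma'(z)^2=f(z)\qquad\forall\gamma\in\Gamma,\ z\in\mathbb{D},$$ then $\delta\chi$ defined by $$\gamma\mapsto\chi(\gamma)\gamma'^{-1}-\chi,\qquad\gamma\in\Gamma,$$ is a $1$-cocycle $c$ for the group $\Gamma$ with coefficients in $\mathfrak{g}$, and its cohomology class $[c]$ depends only on $q$.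
   Context: $\mathbb{D}=\{|z|<1\}$ carries $\mathbf{g}_{\mathbb{D}}=4(dx^2+dy^2)/(1-|z|^2)^2$; the linear connection is induced by its Levi-Civita connection. Vector fields are identified with $\mathbb{C}$-valued functions. Harmonic vector field: for a smooth map $\phi:U\to \mathbb{D}$ from an open set $U\subseteq \mathbb{D}$, the tension field is $\tau(\phi)=\mathrm{trace}(\nabla d\phi)$, with $\nabla$ the connection on $T^*U\otimes\phi^{-1}T\mathbb{D}$ induced by the Levi-Civita connections. A smooth vector field $\xi$ on $U$ is harmonic if there is a smooth family of smooth maps $\phi_t:U\to \mathbb{D}$, $t\in[0,\epsilon)$, such that $\phi_0$ is the inclusion, $\frac{d\phi_t}{dt}|_{t=0}=\xi$, and $\frac{d}{dt}|_{t=0}\tau(\phi_t)(x)=0$ for all $x\in U$ (computed in the standard coordinates of $\mathbb{C}$). $(2,0)$-part: the trace-free part of the Lie derivative $\mathcal{L}_\xi\mathbf{g}_{\mathbb{D}}$ can be written uniquely as the real part of $h\,dz^2$ with $h$ complex-valued, and $(\mathcal{L}_\xi\mathbf{g}_{\mathbb{D}})^{(2,0)}:=h\,dz^2$. $L^2$-extension: a continuous vector field $X$ on $\mathbb{D}$ has an $L^2$-extension to $\overline{\mathbb{D}}$ if the vector fields $X_\epsilon(z)=X((1-\epsilon)z)$ on $\mathbb{S}^1$ converge as $\epsilon\to0$ in the Hilbert space of $L^2$-vector fields ($\mathbb{C}$-valued functions) on $\mathbb{S}^1$; the limit is the restriction of the extension to $\mathbb{S}^1$. An $L^2$-vector field on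 $\mathbb{S}^1$ is tangential if it is of the form $z\mapsto f(z)\,iz$ with $f$ real-valued. Cohomology: $\Gamma$ acts on vector fields on $\mathbb{D}$ by $(\gamma^*F)(z)=F(\gamma(z))\gamma'(z)^{-1}$. A $1$-cocycle with values in a $\Gamma$-module $\mathfrak{M}$ is a map $c:\Gamma\to\mathfrak{M}$ with $c_{\gamma_1\circ\gamma_2}=\gamma_2^*c_{\gamma_1}+c_{\gamma_2}$; the coboundary of $m\in\mathfrak{M}$ is $\gamma\mapsto\gamma^*m-m$; $H^1(\Gamma;\mathfrak{M})$ is cocycles modulo coboundaries. *)

theory Defs
  imports "HOL-Complex_Analysis.Complex_Analysis" "HOL-Algebra.Bij"
begin

section \<open>Smooth maps\<close>

text \<open>For open \<open>S\<close>, \<open>Ck_on k S f\<close> says that \<open>f\<close> is of class \<open>C\<^sup>k\<close> on \<open>S\<close> (finite-dimensional domain).\<close>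

primrec Ck_on ::
  "nat \<Rightarrow> 'a::real_normed_vector set \<Rightarrow> ('a \<Rightarrow> 'b::real_normed_vector) \<Rightarrow> bool" where
  "Ck_on 0 S f \<longleftrightarrow> continuous_on S f"
| "Ck_on (Suc k) S f \<longleftrightarrow>
     (\<forall>x\<in>S. f differentiable (at x)) \<and> (\<forall>v. Ck_on k S (\<lambda>x. frechet_derivative f (at x) v))"

text \<open>Smoothness on an arbitrary set, which need not be open, means that there are smooth local
  extensions. This is needed for families parametrised by a half-open interval \<open>[0,\<epsilon>)\<close>.\<close>

definition smooth_on ::
  "'a::real_normed_vector set \<Rightarrow> ('a \<Rightarrow> 'b::real_normed_vector) \<Rightarrow> bool" where
  "smooth_on S f \<longleftrightarrow>
     (\<forall>p\<in>S. \<exists>W F. open W \<and> p \<in> W \<and> (\<forall>k. Ck_on k W F) \<and> (\<forall>x\<in>S \<inter> W. F x = f x))"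


section \<open>The hyperbolic disc\<close>

abbreviation disc :: "complex set" where
  "disc \<equiv> ball 0 1"

definition hyp_metric :: "complex \<Rightarrow> complex \<Rightarrow> complex \<Rightarrow> real" where
  "hyp_metric z u v = 4 * (u \<bullet> v) / (1 - (cmod z)\<^sup>2)\<^sup>2"

definition hyp_norm :: "complex \<Rightarrow> complex \<Rightarrow> real" where
  "hyp_norm z u = sqrt (hyp_metric z u u)"

text \<open>The trace with respect to the metric of a bilinear form on the tangent space at \<open>z\<close>;
  the basis \<open>{1, \<i>}\<close> of \<open>\<complex>\<close> is orthogonal for \<open>hyp_metric z\<close>.\<close>

definition hyp_trace ::
  "complex \<Rightarrow> (complex \<Rightarrow> complex \<Rightarrow> 'a::real_vector) \<Rightarrow> 'a" where
  "hyp_trace z B = (\<Sum>e\<in>Basis. (1 / hyp_metric z e e) *\<^sub>R B e e)"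

text \<open>The Christoffel map of the Levi-Civita connection: \<open>christoffel z u v\<close> is the value at \<open>z\<close> of
  \<open>\<nabla>\<^sub>u v\<close> for the constant vector fields \<open>u\<close> and \<open>v\<close>, as given by the Koszul formula.\<close>

definition christoffel :: "complex \<Rightarrow> complex \<Rightarrow> complex \<Rightarrow> complex" where
  "christoffel z u v = (THE x. \<forall>w. 2 * hyp_metric z x w =
      frechet_derivative (\<lambda>y. hyp_metric y v w) (at z) u
    + frechet_derivative (\<lambda>y. hyp_metric y u w) (at z) v
    - frechet_derivative (\<lambda>y. hyp_metric y u v) (at z) w)"


section \<open>Tension field and harmonic vector fields\<close>

text \<open>\<open>second_fundamental_form \<phi> x u v\<close> is \<open>(\<nabla>d\<phi>)\<^sub>x(u, v)\<close> for the connection on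
  \<open>T\<^sup>*U \<otimes> \<phi>\<^sup>-\<^sup>1TD\<close> (\<open>D\<close> the disc) induced by the Levi-Civita connections.\<close>

definition second_fundamental_form ::
  "(complex \<Rightarrow> complex) \<Rightarrow> complex \<Rightarrow> complex \<Rightarrow> complex \<Rightarrow> complex" where
  "second_fundamental_form \<phi> x u v =
      frechet_derivative (\<lambda>y. frechet_derivative \<phi> (at y) v) (at x) u
    - frechet_derivative \<phi> (at x) (christoffel x u v)
    + christoffel (\<phi> x) (frechet_derivative \<phi> (at x) u) (frechet_derivative \<phi> (at x) v)"

definition tension :: "(complex \<Rightarrow> complex) \<Rightarrow> complex \<Rightarrow> complex" where
  "tension \<phi> x = hyp_trace x (second_fundamental_form \<phi> x)"

definition harmonic_vector_field :: "complex set \<Rightarrow> (complex \<Rightarrow> complex) \<Rightarrow> bool" where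
  "harmonic_vector_field U \<xi> \<longleftrightarrow> smooth_on U \<xi> \<and>
     (\<exists>\<epsilon>>0. \<exists>\<phi> :: real \<Rightarrow> complex \<Rightarrow> complex.
        smooth_on ({0..<\<epsilon>} \<times> U) (\<lambda>(t, x). \<phi> t x) \<and>
        (\<forall>t\<in>{0..<\<epsilon>}. \<phi> t ` U \<subseteq> disc) \<and>
        (\<forall>x\<in>U. \<phi> 0 x = x) \<and>
        (\<forall>x\<in>U. ((\<lambda>t. \<phi> t x) has_vector_derivative \<xi> x) (at 0 within {0..<\<epsilon>})) \<and>
        (\<forall>x\<in>U. ((\<lambda>t. tension (\<phi> t) x) has_vector_derivative 0) (at 0 within {0..<\<epsilon>})))"


section \<open>Lie derivative of the metric and Killing fields\<close>

text \<open>\<open>(\<L>\<^sub>\<xi> g)(u, v) = \<xi>(g(u, v)) - g([\<xi>, u], v) - g(u, [\<xi>, v])\<close>, where \<open>[\<xi>, u] = - d\<xi>(u)\<close> for the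
  constant vector field \<open>u\<close>.\<close>

definition lie_metric ::
  "(complex \<Rightarrow> complex) \<Rightarrow> complex \<Rightarrow> complex \<Rightarrow> complex \<Rightarrow> real" where
  "lie_metric \<xi> z u v =
      frechet_derivative (\<lambda>y. hyp_metric y u v) (at z) (\<xi> z)
    + hyp_metric z (frechet_derivative \<xi> (at z) u) v
    + hyp_metric z u (frechet_derivative \<xi> (at z) v)"

definition lie_metric_trace_free ::
  "(complex \<Rightarrow> complex) \<Rightarrow> complex \<Rightarrow> complex \<Rightarrow> complex \<Rightarrow> real" where
  "lie_metric_trace_free \<xi> z u v =
     lie_metric \<xi> z u v - hyp_trace z (lie_metric \<xi> z) / 2 * hyp_metric z u v"

text \<open>The coefficient \<open>h\<close> of \<open>(\<L>\<^sub>\<xi> g)\<^sup>(\<^sup>2\<^sup>,\<^sup>0\<^sup>) = h dz\<^sup>2\<close>; recall \<open>dz\<^sup>2(u, v) = u v\<close>.\<close>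

definition lie_metric_20 :: "(complex \<Rightarrow> complex) \<Rightarrow> complex \<Rightarrow> complex" where
  "lie_metric_20 \<xi> z = (THE h. \<forall>u v. lie_metric_trace_free \<xi> z u v = Re (h * (u * v)))"

text \<open>Vector fields that are elements of a module are represented by functions that are
  \<open>undefined\<close> off the disc, so that they are equal exactly when they agree on the disc.\<close>

definition killing_fields :: "(complex \<Rightarrow> complex) set" where
  "killing_fields =
     {\<xi> \<in> extensional disc. smooth_on disc \<xi> \<and> (\<forall>z\<in>disc. \<forall>u v. lie_metric \<xi> z u v = 0)}"


section \<open>Orientation preserving isometries\<close>

text \<open>The last condition says that the determinant of the real linear map
  \<open>frechet_derivative \<gamma> (at z)\<close> is positive.\<close>

definition isom_plus :: "(complex \<Rightarrow> complex) monoid" where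
  "isom_plus = (BijGroup disc)\<lparr>carrier := {\<gamma> \<in> Bij disc.
     smooth_on disc \<gamma> \<and> smooth_on disc (inv_into disc \<gamma>) \<and>
     (\<forall>z\<in>disc. \<forall>u v. hyp_metric (\<gamma> z)
        (frechet_derivative \<gamma> (at z) u) (frechet_derivative \<gamma> (at z) v) = hyp_metric z u v) \<and>
     (\<forall>z\<in>disc. Im (cnj (frechet_derivative \<gamma> (at z) 1) * frechet_derivative \<gamma> (at z) \<i>) > 0)}\<rparr>"


section \<open>Covariant derivatives of quadratic differentials\<close>

text \<open>A complex valued covariant tensor field of rank \<open>k\<close> is represented by a function that takes a
  point and a list of \<open>k\<close> tangent vectors. In \<open>cov_deriv T\<close> the direction of differentiation is
  the first vector of the list.\<close>

definition quad_diff :: "(complex \<Rightarrow> complex) \<Rightarrow> complex \<Rightarrow> complex list \<Rightarrow> complex" where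
  "quad_diff f z us = f z * (us ! 0 * us ! 1)"

fun cov_deriv ::
  "(complex \<Rightarrow> complex list \<Rightarrow> complex) \<Rightarrow> complex \<Rightarrow> complex list \<Rightarrow> complex" where
  "cov_deriv T z [] = 0"
| "cov_deriv T z (w # us) =
      frechet_derivative (\<lambda>y. T y us) (at z) w
    - (\<Sum>i<length us. T z (us[i := christoffel z w (us ! i)]))"

definition hyp_bounded :: "nat \<Rightarrow> (complex \<Rightarrow> complex list \<Rightarrow> complex) \<Rightarrow> bool" where
  "hyp_bounded k T \<longleftrightarrow> (\<exists>C. \<forall>z\<in>disc. \<forall>us. length us = k \<longrightarrow>
     cmod (T z us) \<le> C * prod_list (map (hyp_norm z) us))"


section \<open>Extension to the circle\<close>

definition circle_measure :: "complex measure" where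
  "circle_measure =
     distr (restrict_space lborel {0..<2 * pi}) (restrict_space borel (sphere 0 1)) cis"

definition L2_on_circle :: "(complex \<Rightarrow> complex) \<Rightarrow> bool" where
  "L2_on_circle Y \<longleftrightarrow>
     Y \<in> borel_measurable circle_measure \<and> integrable circle_measure (\<lambda>z. (cmod (Y z))\<^sup>2)"

text \<open>\<open>Y\<close> represents the restriction to the circle of the \<open>L\<^sup>2\<close>-extension of \<open>X\<close>.
  As \<open>X\<close> is continuous on the disc, all of the integrands with \<open>0 < \<epsilon> < 1\<close> are integrable.\<close>

definition has_L2_extension :: "(complex \<Rightarrow> complex) \<Rightarrow> (complex \<Rightarrow> complex) \<Rightarrow> bool" where
  "has_L2_extension X Y \<longleftrightarrow> continuous_on disc X \<and> L2_on_circle Y \<and>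
     ((\<lambda>\<epsilon>. LINT z|circle_measure. (cmod (X (complex_of_real (1 - \<epsilon>) * z) - Y z))\<^sup>2)
        \<longlongrightarrow> 0) (at_right 0)"

definition tangential :: "(complex \<Rightarrow> complex) \<Rightarrow> bool" where
  "tangential Y \<longleftrightarrow>
     (\<exists>f :: complex \<Rightarrow> real. AE z in circle_measure. Y z = complex_of_real (f z) * (\<i> * z))"

definition has_tangential_L2_extension :: "(complex \<Rightarrow> complex) \<Rightarrow> bool" where
  "has_tangential_L2_extension X \<longleftrightarrow> (\<exists>Y. has_L2_extension X Y \<and> tangential Y)"


section \<open>Group cohomology with coefficients in vector fields\<close>

definition pullback :: "(complex \<Rightarrow> complex) \<Rightarrow> (complex \<Rightarrow> complex) \<Rightarrow> complex \<Rightarrow> complex" where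
  "pullback \<gamma> F = (\<lambda>z\<in>disc. F (\<gamma> z) * inverse (deriv \<gamma> z))"

text \<open>In the following, \<open>M\<close> is a set of vector fields on the disc (the module of coefficients).\<close>

definition cocycles ::
  "(complex \<Rightarrow> complex) set \<Rightarrow> (complex \<Rightarrow> complex) set \<Rightarrow>
   ((complex \<Rightarrow> complex) \<Rightarrow> (complex \<Rightarrow> complex)) set" where
  "cocycles \<Gamma> M = {c \<in> \<Gamma> \<rightarrow>\<^sub>E M. \<forall>\<gamma>\<^sub>1\<in>\<Gamma>. \<forall>\<gamma>\<^sub>2\<in>\<Gamma>.
     c (compose disc \<gamma>\<^sub>1 \<gamma>\<^sub>2) = (\<lambda>z\<in>disc. pullback \<gamma>\<^sub>2 (c \<gamma>\<^sub>1) z + c \<gamma>\<^sub>2 z)}"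

definition coboundary ::
  "(complex \<Rightarrow> complex) set \<Rightarrow> (complex \<Rightarrow> complex) \<Rightarrow>
   (complex \<Rightarrow> complex) \<Rightarrow> (complex \<Rightarrow> complex)" where
  "coboundary \<Gamma> m = (\<lambda>\<gamma>\<in>\<Gamma>. \<lambda>z\<in>disc. pullback \<gamma> m z - m z)"

definition cohomologous ::
  "(complex \<Rightarrow> complex) set \<Rightarrow> (complex \<Rightarrow> complex) set \<Rightarrow>
   (((complex \<Rightarrow> complex) \<Rightarrow> (complex \<Rightarrow> complex)) \<times>
    ((complex \<Rightarrow> complex) \<Rightarrow> (complex \<Rightarrow> complex))) set" where
  "cohomologous \<Gamma> M = {(c, c'). c \<in> cocycles \<Gamma> M \<and> c' \<in> cocycles \<Gamma> M \<and>
     (\<exists>m\<in>M. \<forall>\<gamma>\<in>\<Gamma>. \<forall>z\<in>disc. c' \<gamma> z - c \<gamma> z = coboundary \<Gamma> m \<gamma> z)}"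

text \<open>The class of a cocycle is an element of \<open>H\<^sup>1(\<Gamma>; M) = cocycles \<Gamma> M // cohomologous \<Gamma> M\<close>.\<close>

definition cohomology_class ::
  "(complex \<Rightarrow> complex) set \<Rightarrow> (complex \<Rightarrow> complex) set \<Rightarrow>
   ((complex \<Rightarrow> complex) \<Rightarrow> (complex \<Rightarrow> complex)) \<Rightarrow>
   ((complex \<Rightarrow> complex) \<Rightarrow> (complex \<Rightarrow> complex)) set" where
  "cohomology_class \<Gamma> M c = cohomologous \<Gamma> M `` {c}"

end

theory Submission
  imports Defs
begin

text \<open>Write \<open>D\<close> for the real derivative of a vector field \<open>\<xi>\<close>. The coefficient \<open>lie_metric_20 \<xi>\<close> is
  \<open>4 / (1 - |z|\<^sup>2)\<^sup>2\<close> times the conjugate of \<open>D 1 + \<i> D \<i>\<close>, i.e. of twice the d-bar derivative. Hence the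
  bound on \<open>q\<close> bounds the d-bar derivative, and by invariance of \<open>q\<close> the difference \<open>\<eta>\<close> of \<open>\<gamma>\<^sup>*\<xi>\<close> and
  \<open>\<xi>\<close>, like the difference of two fields with the same \<open>q\<close>, is holomorphic. Its Fourier coefficients on
  circles \<open>|z| = s\<close> converge for \<open>s \<rightarrow> 1\<close> to those of a tangential field \<open>Z\<close>; as
  \<open>Z = - z\<^sup>2 cnj Z\<close> on the circle, only three coefficients survive, and
  \<open>\<eta> = a + b z - cnj a z\<^sup>2\<close> with \<open>Re b = 0\<close>, which is a Killing field.\<close>

section \<open>Circle integrals and the d-bar derivative\<close>

text \<open>The obstacle lies at the boundary. The L2-extension controls \<xi> along concentric
  circles only, while the pullback along a concentric circle reads \<xi> on the image of that circle
  under \<gamma>. Two facts overcome this. An orientation preserving isometry is a Moebius function,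
  hence holomorphic beyond the unit circle and a diffeomorphism of it with derivative bounded below,
  so boundary values can be substituted in L2. And a bounded d-bar derivative makes weighted
  integrals over two nearby circles differ by at most a multiple of the distance between them, so
  that limits can be compared. The pullback stays tangential because on the circle the derivative of
  \<gamma> at z is a positive multiple of \<gamma>(z)/z: dividing by it turns tangent vectors at
  \<gamma>(z) into tangent vectors at z. The cocycle identity is formal, \<delta>\<xi> being a
  coboundary in the module of all vector fields; the content is that its values are Killing.
  Independence of the choice of \<xi> is the same computation with two fields and the identity as
  isometry: their difference is itself Killing, so the two cocycles differ by the coboundary of an
  element of the coefficient module.\<close>

lemma real_linear_complex_eq:
  fixes D :: "complex \<Rightarrow> complex"
  assumes "linear D"
  shows "D v = of_real (Re v) * D 1 + of_real (Im v) * D \<i>"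
proof -
  have "v = Re v *\<^sub>R 1 + Im v *\<^sub>R \<i>"
    by (simp add: complex_eq_iff)
  then have "D v = D (Re v *\<^sub>R 1 + Im v *\<^sub>R \<i>)" by simp
  also have "\<dots> = Re v *\<^sub>R D 1 + Im v *\<^sub>R D \<i>"
    by (simp only: linear_add[OF assms] linear_scale[OF assms])
  finally show ?thesis by (simp add: scaleR_conv_of_real)
qed

text \<open>The left side annihilates the complex linear part of \<open>D\<close>, hence is
  conjugate linear in \<open>v\<close>. With \<open>v\<close> the derivative of a holomorphic inner
  map this is the chain rule for d-bar.\<close>

lemma dbar_rotate:
  fixes D :: "complex \<Rightarrow> complex"
  assumes "linear D"
  shows "D v + \<i> * D (\<i> * v) = cnj v * (D 1 + \<i> * D \<i>)"
  by (subst (1 2) real_linear_complex_eq[OF assms]) (simp add: algebra_simps complex_eq_iff)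

lemma has_vector_derivative_cis:
  "(cis has_vector_derivative \<i> * cis t) (at t within S)"
proof -
  have "((\<lambda>z. exp (\<i> * z)) has_field_derivative \<i> * cis t) (at (of_real t))"
    by (auto intro!: derivative_eq_intros simp: cis_conv_exp)
  from has_vector_derivative_real_field[OF this, of S] show ?thesis
    by (simp flip: cis_conv_exp)
qed

text \<open>In the derivative of the circle integral with respect to the radius, integration by parts along
  the circle cancels everything but the d-bar derivative of \<open>G\<close>.\<close>

lemma circle_integral_dbar_bound:
  fixes G :: "complex \<Rightarrow> complex" and D :: "complex \<Rightarrow> complex \<Rightarrow> complex"
  assumes s: "0 < s" "s \<le> 1"
    and deriv: "\<And>z. s \<le> cmod z \<Longrightarrow> cmod z \<le> 1 \<Longrightarrow> (G has_derivative D z) (at z)"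
    and cont1: "continuous_on {z. s \<le> cmod z \<and> cmod z \<le> 1} (\<lambda>z. D z 1)"
    and contI: "continuous_on {z. s \<le> cmod z \<and> cmod z \<le> 1} (\<lambda>z. D z \<i>)"
    and bound: "\<And>z. s \<le> cmod z \<Longrightarrow> cmod z \<le> 1 \<Longrightarrow> cmod (D z 1 + \<i> * D z \<i>) \<le> M"
  shows "cmod (integral {0..2*pi} (\<lambda>t. G (cis t) * cis t) -
           integral {0..2*pi} (\<lambda>t. G (of_real s * cis t) * (of_real s * cis t))) \<le> 2 * pi * M * (1 - s)"
proof -
  let ?A = "{z. s \<le> cmod z \<and> cmod z \<le> 1}"
  let ?p = "\<lambda>r t. complex_of_real r * cis t"
  have M: "0 \<le> M" using bound[of 1] s order_trans[OF norm_ge_zero] by auto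
  have lin: "linear (D z)" if "z \<in> ?A" for z
    using deriv that has_derivative_linear by blast
  have inA: "?p r t \<in> ?A" if "r \<in> {s..1}" for r t
    using that s by (auto simp: norm_mult)
  have contG: "continuous_on ?A G"
    using deriv by (auto intro!: continuous_at_imp_continuous_on has_derivative_continuous)
  have contp: "continuous_on ({s..1} \<times> {0..2*pi}) (\<lambda>(r,t). ?p r t)"
    by (auto intro!: continuous_intros simp: case_prod_beta)
  define f where "f = (\<lambda>r t. G (?p r t) * ?p r t)"
  define fx where "fx = (\<lambda>r t. D (?p r t) (cis t) * ?p r t + G (?p r t) * cis t)"
  have cont_pair: "continuous_on ({s..1} \<times> {0..2*pi}) (\<lambda>(r,t). h (?p r t))"
    if "continuous_on ?A h" for h :: "complex \<Rightarrow> complex"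
    unfolding case_prod_beta
    by (rule continuous_on_compose2[OF that contp[unfolded case_prod_beta]]) (use inA in auto)
  \<comment> \<open>The hypotheses give continuity for the fixed directions 1 and \<i>; the moving
    direction \<open>cis t\<close> is expanded in this basis.\<close>
  have contD: "continuous_on ({s..1} \<times> {0..2*pi}) (\<lambda>(r,t). D (?p r t) (cis t))"
  proof -
    have "continuous_on ({s..1} \<times> {0..2*pi})
       (\<lambda>(r,t). of_real (cos t) * D (?p r t) 1 + of_real (sin t) * D (?p r t) \<i>)"
      using cont_pair[OF cont1] cont_pair[OF contI]
      by (auto intro!: continuous_intros simp: case_prod_beta)
    then show ?thesis
      by (rule continuous_on_eq) (use lin inA in \<open>force simp: real_linear_complex_eq[of "D _" "cis _"]\<close>)
  qed
  have contfx: "continuous_on ({s..1} \<times> {0..2*pi}) (\<lambda>(r,t). fx r t)"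
    using contD cont_pair[OF contG] contp unfolding fx_def case_prod_beta
    by (intro continuous_intros) auto
  have contf: "continuous_on {0..2*pi} (f r)" if "r \<in> {s..1}" for r
    unfolding f_def
    by (intro continuous_intros continuous_on_compose2[OF contG]) (use inA that in auto)
  have der_f: "((\<lambda>r. f r t) has_vector_derivative fx r t) (at r within {s..1})"
    if "r \<in> {s..1}" for r t
  proof -
    have "(G has_derivative D (?p r t)) (at (?p r t) within (\<lambda>r. ?p r t) ` {s..1})"
      using deriv inA[OF that] by (auto intro: has_derivative_at_withinI)
    moreover have "((\<lambda>r. ?p r t) has_vector_derivative cis t) (at r within {s..1})"
      by (auto intro!: derivative_eq_intros)
    ultimately have "((\<lambda>r. G (?p r t)) has_vector_derivative D (?p r t) (cis t)) (at r within {s..1})"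
      using vector_derivative_diff_chain_within by (fastforce simp: o_def)
    then show ?thesis
      unfolding f_def fx_def
      by (auto intro!: derivative_eq_intros)
  qed
  define J where "J = (\<lambda>r. integral {0..2*pi} (f r))"
  have der_J: "(J has_vector_derivative integral {0..2*pi} (fx r)) (at r within {s..1})"
    if "r \<in> {s..1}" for r
    using leibniz_rule_vector_derivative[of "{s..1}" 0 "2*pi" f fx r] der_f contf contfx that
    by (auto simp: J_def integrable_continuous_real)
  have bnd: "cmod (integral {0..2*pi} (fx r)) \<le> 2 * pi * M" if r: "r \<in> {s..1}" for r
  proof -
    \<comment> \<open>\<open>e\<close> is the angular derivative of \<open>G * cis t\<close>, taken
      without the factor r, so its integral over a full turn vanishes. Adding
      \<open>\<i> * e\<close> to \<open>fx\<close> cancels the two terms containing \<open>G\<close>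
      and completes the terms in \<open>D\<close> to the d-bar derivative.\<close>
    define e where "e = (\<lambda>t. D (?p r t) (\<i> * ?p r t) * cis t + G (?p r t) * (\<i> * cis t))"
    have "((\<lambda>t. G (?p r t) * cis t) has_vector_derivative e t) (at t within {0..2*pi})" for t
    proof -
      have "(G has_derivative D (?p r t)) (at (?p r t) within (\<lambda>t. ?p r t) ` {0..2*pi})"
        using deriv inA[OF r] by (auto intro: has_derivative_at_withinI)
      moreover have "((\<lambda>t. ?p r t) has_vector_derivative \<i> * ?p r t) (at t within {0..2*pi})"
        using has_vector_derivative_mult_right[OF has_vector_derivative_cis, of "of_real r"]
        by (simp add: mult.left_commute)
      ultimately have 1: "((\<lambda>t. G (?p r t)) has_vector_derivative D (?p r t) (\<i> * ?p r t)) (at t within {0..2*pi})"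
        using vector_derivative_diff_chain_within by (fastforce simp: o_def)
      show ?thesis unfolding e_def
        using has_vector_derivative_mult[OF 1 has_vector_derivative_cis] by (simp add: add.commute)
    qed
    then have e: "(e has_integral 0) {0..2*pi}"
      using fundamental_theorem_of_calculus[of 0 "2*pi" "\<lambda>t. G (?p r t) * cis t" e] by simp
    have fxi: "(fx r has_integral integral {0..2*pi} (fx r)) {0..2*pi}"
    proof -
      have "continuous_on {0..2*pi} (\<lambda>t. (\<lambda>(r,t). fx r t) (r, t))"
        by (rule continuous_on_compose2[OF contfx]) (use r in \<open>auto intro!: continuous_intros\<close>)
      then show ?thesis
        by (intro integrable_integral integrable_continuous_real) simp
    qed
    have "((\<lambda>t. fx r t + \<i> * e t) has_integral integral {0..2*pi} (fx r)) {0..2*pi}"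
      using has_integral_add[OF fxi has_integral_mult_right[OF e, of \<i>]] by simp
    moreover have "cmod (fx r t + \<i> * e t) \<le> M" for t
    proof -
      let ?z = "?p r t"
      have "fx r t + \<i> * e t = ?z * (D ?z (cis t)) + \<i> * D ?z (\<i> * ?z) * cis t"
        unfolding fx_def e_def by (simp add: algebra_simps)
      also have "D ?z (\<i> * ?z) = of_real r * D ?z (\<i> * cis t)"
        using linear_scale[OF lin[OF inA[OF r, of t]], of r "\<i> * cis t"]
        by (simp add: scaleR_conv_of_real algebra_simps)
      also have "?z * (D ?z (cis t)) + \<i> * (of_real r * D ?z (\<i> * cis t)) * cis t =
         ?z * (D ?z (cis t) + \<i> * D ?z (\<i> * cis t))"
        by (simp add: algebra_simps)
      also have "D ?z (cis t) + \<i> * D ?z (\<i> * cis t) = cnj (cis t) * (D ?z 1 + \<i> * D ?z \<i>)"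
        by (rule dbar_rotate[OF lin[OF inA[OF r]]])
      finally have "cmod (fx r t + \<i> * e t) = \<bar>r\<bar> * cmod (D ?z 1 + \<i> * D ?z \<i>)"
        by (simp add: norm_mult)
      also have "\<dots> \<le> 1 * M"
        using inA[OF r, of t] r s M by (intro mult_mono bound) (auto simp: norm_mult)
      finally show ?thesis by simp
    qed
    ultimately show ?thesis
      using has_integral_bound[of M "\<lambda>t. fx r t + \<i> * e t" _ 0 "2*pi"] M
      by (simp add: mult.commute)
  qed
  have "norm (J 1 - J s) \<le> 2 * pi * M * norm (1 - s)"
  proof (rule differentiable_bound)
    show "convex {s..1}" by simp
    show "(J has_derivative (\<lambda>x. x *\<^sub>R integral {0..2*pi} (fx r))) (at r within {s..1})"
      if "r \<in> {s..1}" for r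
      using der_J[OF that] by (simp add: has_vector_derivative_def)
    show "onorm (\<lambda>x. x *\<^sub>R integral {0..2*pi} (fx r)) \<le> 2 * pi * M" if "r \<in> {s..1}" for r
      using bnd[OF that] M by (intro onorm_le) (auto simp: mult.commute intro!: mult_left_mono)
  qed (use s in auto)
  then show ?thesis using s by (simp add: J_def f_def)
qed

section \<open>Fourier coefficients of holomorphic functions\<close>

definition circle_coeff :: "(complex \<Rightarrow> complex) \<Rightarrow> int \<Rightarrow> real \<Rightarrow> complex" where
  "circle_coeff h n r = integral {0..2*pi} (\<lambda>t. h (of_real r * cis t) * cis (- of_int n * t))"

text \<open>For nonnegative \<open>n\<close> this is Cauchy's formula for the higher derivatives,
  for negative \<open>n\<close> Cauchy's theorem, since the integrand is then holomorphic. The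
  factor 2 pi appears because \<open>circle_coeff\<close> is not normalised.\<close>

lemma circle_coeff_holomorphic:
  fixes \<eta> :: "complex \<Rightarrow> complex" and n :: int
  assumes holo: "\<eta> holomorphic_on disc" and r: "0 < r" "r < 1"
  shows "circle_coeff \<eta> n r =
    (if n \<ge> 0 then 2 * pi * ((deriv ^^ nat n) \<eta> 0 / fact (nat n)) * of_real r ^ nat n else 0)"
proof (cases "n \<ge> 0")
  case True
  then obtain k where n: "n = int k" by (metis nonneg_int_cases)
  let ?c = "(2 * pi * \<i>) / (fact k) * (deriv ^^ k) \<eta> 0"
  have "((\<lambda>u. \<eta> u / (u - 0) ^ Suc k) has_contour_integral ?c) (circlepath 0 r)"
    using r holo
    by (intro Cauchy_has_contour_integral_higher_derivative_circlepath)
       (auto intro!: holomorphic_on_imp_continuous_on elim: holomorphic_on_subset)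
  then have "((\<lambda>t. \<eta> (of_real r * cis t) / (of_real r * cis t) ^ Suc k * r * \<i> * cis t) has_integral ?c) {0..2*pi}"
    unfolding circlepath_def by (subst (asm) has_contour_integral_part_circlepath_iff) auto
  then have "((\<lambda>t. (of_real r ^ k / \<i>) * (\<eta> (of_real r * cis t) / (of_real r * cis t) ^ Suc k * r * \<i> * cis t))
      has_integral (of_real r ^ k / \<i>) * ?c) {0..2*pi}"
    by (rule has_integral_mult_right)
  moreover have "(of_real r ^ k / \<i>) * (\<eta> (of_real r * cis t) / (of_real r * cis t) ^ Suc k * r * \<i> * cis t)
     = \<eta> (of_real r * cis t) * cis (- of_int n * t)" for t
  proof -
    have "cis (- of_int n * t) = inverse (cis t ^ k)"
      by (simp add: Complex.DeMoivre n)
    then show ?thesis using r by (simp add: field_simps power_mult_distrib)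
  qed
  ultimately have "((\<lambda>t. \<eta> (of_real r * cis t) * cis (- of_int n * t)) has_integral (of_real r ^ k / \<i>) * ?c) {0..2*pi}"
    by simp
  then show ?thesis
    unfolding circle_coeff_def using n by (subst integral_unique) (auto simp: field_simps)
next
  case False
  \<comment> \<open>The contour element contributes one of the \<open>- n\<close> factors
    \<open>cis t\<close>.\<close>
  define k where "k = nat (- n) - 1"
  have n: "n = - int (Suc k)" using False by (simp add: k_def)
  have "((\<lambda>u. \<eta> u * u ^ k) has_contour_integral 0) (circlepath 0 r)"
    by (rule Cauchy_theorem_convex_simple[of _ "disc"])
       (use r holo in \<open>auto intro!: holomorphic_intros simp: path_image_circlepath\<close>)
  then have "((\<lambda>t. \<eta> (of_real r * cis t) * (of_real r * cis t) ^ k * r * \<i> * cis t) has_integral 0) {0..2*pi}"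
    unfolding circlepath_def by (subst (asm) has_contour_integral_part_circlepath_iff) auto
  then have "((\<lambda>t. inverse (\<i> * of_real r ^ Suc k) *
       (\<eta> (of_real r * cis t) * (of_real r * cis t) ^ k * r * \<i> * cis t)) has_integral
         inverse (\<i> * of_real r ^ Suc k) * 0) {0..2*pi}"
    by (rule has_integral_mult_right)
  moreover have "inverse (\<i> * of_real r ^ Suc k) *
       (\<eta> (of_real r * cis t) * (of_real r * cis t) ^ k * r * \<i> * cis t)
     = \<eta> (of_real r * cis t) * cis (- of_int n * t)" for t
  proof -
    have "cis (- of_int n * t) = cis t ^ Suc k"
      by (simp only: Complex.DeMoivre n) (simp add: add.commute)
    then show ?thesis using r by (simp add: field_simps power_mult_distrib)
  qed
  ultimately have "((\<lambda>t. \<eta> (of_real r * cis t) * cis (- of_int n * t)) has_integral 0) {0..2*pi}"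
    by simp
  then show ?thesis
    unfolding circle_coeff_def using False by (subst integral_unique) auto
qed

text \<open>The reflection of \<open>n\<close> to \<open>2 - n\<close> exchanges the negative
  indices, where a holomorphic function has no coefficients, with those above 2. It also exchanges 0
  with 2, and at its fixed point 1 it forces an imaginary coefficient.\<close>

lemma holomorphic_tangential_quadratic:
  fixes \<eta> :: "complex \<Rightarrow> complex"
  assumes holo: "\<eta> holomorphic_on disc"
    and lim: "\<And>n. (circle_coeff \<eta> n \<longlongrightarrow> A n) (at_left 1)"
    and sym: "\<And>n. A n = - cnj (A (2 - n))"
  obtains a b where "Re b = 0" "\<And>z. z \<in> disc \<Longrightarrow> \<eta> z = a + b * z - cnj a * z\<^sup>2"
proof -
  define c where "c = (\<lambda>k. (deriv ^^ k) \<eta> 0 / fact k)"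
  have ev: "\<forall>\<^sub>F r in at_left (1::real). 0 < r \<and> r < 1"
    using eventually_at_left_real[of 0 1] by (auto elim!: eventually_mono)
  have A: "A n = (if n \<ge> 0 then 2 * pi * c (nat n) else 0)" for n
  proof (rule tendsto_unique[OF _ lim])
    have "((\<lambda>r. if n \<ge> 0 then 2 * pi * c (nat n) * of_real r ^ nat n else 0) \<longlongrightarrow>
        (if n \<ge> 0 then 2 * pi * c (nat n) * of_real 1 ^ nat n else 0)) (at_left (1::real))"
      by (cases "n \<ge> 0") (simp_all only: if_True if_False, (intro tendsto_intros)+)
    then show "(circle_coeff \<eta> n \<longlongrightarrow> (if n \<ge> 0 then 2 * pi * c (nat n) else 0)) (at_left 1)"
      by (simp only: power_one of_real_1 mult_1_right)
         (erule Lim_transform_eventually, use ev in eventually_elim,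
          subst circle_coeff_holomorphic[OF holo], auto simp: c_def)
  qed simp
  have high: "c k = 0" if "k \<ge> 3" for k
    using sym[of "int k"] that by (simp add: A)
  have c1: "Re (c 1) = 0"
    using sym[of 1] by (simp add: A complex_eq_iff)
  have c2: "c 2 = - cnj (c 0)"
    using arg_cong[OF sym[of 2], of "\<lambda>x. x / of_real pi"] by (simp add: A)
  have "\<eta> z = c 0 + c 1 * z - cnj (c 0) * z\<^sup>2" if "z \<in> disc" for z
  proof -
    have "(\<lambda>k. c k * z ^ k) sums \<eta> z"
      using holomorphic_power_series[OF holo that] by (simp add: c_def)
    moreover have "(\<lambda>k. c k * z ^ k) sums (\<Sum>k<3. c k * z ^ k)"
      by (rule sums_finite) (auto simp: high)
    ultimately have "\<eta> z = (\<Sum>k<3. c k * z ^ k)"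
      by (rule sums_unique2)
    also have "\<dots> = c 0 + c 1 * z + c 2 * z\<^sup>2"
      by (simp add: numeral_3_eq_3 numeral_2_eq_2)
    finally show ?thesis using c2 by simp
  qed
  with c1 that show ?thesis by blast
qed

section \<open>Smooth maps\<close>

lemma frechet_derivative_eqI: "(f has_derivative D) (at x) \<Longrightarrow> frechet_derivative f (at x) = D"
  by (metis frechet_derivative_at)

text \<open>Allows \<open>frechet_derivative\<close> to be replaced by an explicit formula at each
  level of the recursion in \<open>Ck_on\<close>; openness makes equal functions have equal
  derivatives.\<close>

lemma Ck_on_cong:
  assumes "open S" "\<And>x. x \<in> S \<Longrightarrow> f x = g x"
  shows "Ck_on k S f = Ck_on k S g"
  using assms(2)
proof (induction k arbitrary: f g)
  case (Suc k)
  have hd: "(f has_derivative D) (at x) \<longleftrightarrow> (g has_derivative D) (at x)" if "x \<in> S" for x D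
    using has_derivative_transform_within_open[OF _ assms(1) that] Suc.prems by metis
  then have "f differentiable (at x) \<longleftrightarrow> g differentiable (at x)" if "x \<in> S" for x
    using that by (simp add: differentiable_def)
  moreover have "frechet_derivative f (at x) = frechet_derivative g (at x)" if "x \<in> S" for x
    using hd that by (simp add: frechet_derivative_def)
  ultimately show ?case
    using Suc.IH[of "\<lambda>x. frechet_derivative f (at x) v" "\<lambda>x. frechet_derivative g (at x) v" for v] by auto
qed (simp cong: continuous_on_cong)

text \<open>The directional derivatives \<open>deriv f x * v\<close> are again holomorphic, so the
  induction runs over all holomorphic functions at once.\<close>

lemma holomorphic_imp_Ck_on:
  assumes "open S" "f holomorphic_on S"
  shows "Ck_on k S f"
  using assms(2)
proof (induction k arbitrary: f)
  case 0
  then show ?case by (simp add: holomorphic_on_imp_continuous_on)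
next
  case (Suc k)
  have der: "(f has_derivative (\<lambda>v. deriv f x * v)) (at x)" if "x \<in> S" for x
    using holomorphic_derivI[OF Suc.prems assms(1) that] by (simp add: has_field_derivative_def)
  have "Ck_on k S (\<lambda>x. frechet_derivative f (at x) v)" for v
  proof -
    have "Ck_on k S (\<lambda>x. deriv f x * v)"
      by (intro Suc.IH holomorphic_intros holomorphic_deriv Suc.prems assms(1))
    then show ?thesis
      using Ck_on_cong[OF assms(1), of "\<lambda>x. frechet_derivative f (at x) v" "\<lambda>x. deriv f x * v"]
      by (simp add: frechet_derivative_eqI[OF der])
  qed
  with der show ?case by (auto simp: differentiable_def)
qed

text \<open>On an open set a local extension agrees with \<open>f\<close> near the point, so it has
  the same derivatives. These two facts are the form in which smoothness enters the circle
  integrals.\<close>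

lemma smooth_on_open_imp_deriv:
  assumes "open S" "smooth_on S f"
  shows "\<And>x. x \<in> S \<Longrightarrow> (f has_derivative frechet_derivative f (at x)) (at x)"
    and "continuous_on S (\<lambda>x. frechet_derivative f (at x) v)"
proof -
  have *: "f differentiable (at p) \<and> continuous (at p) (\<lambda>x. frechet_derivative f (at x) v)" if p: "p \<in> S" for p
  proof -
    obtain W F where "open W \<and> p \<in> W \<and> (\<forall>k. Ck_on k W F) \<and> (\<forall>x\<in>S \<inter> W. F x = f x)"
      using bspec[OF assms(2)[unfolded smooth_on_def] p] by (elim exE)
    then have W: "open W" "p \<in> W" "\<And>k. Ck_on k W F" "\<And>x. x \<in> S \<inter> W \<Longrightarrow> F x = f x"
      by auto
    have W': "open (S \<inter> W)" "p \<in> S \<inter> W" using W p assms(1) by auto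
    have C1: "\<And>x. x \<in> W \<Longrightarrow> F differentiable (at x)" "continuous_on W (\<lambda>x. frechet_derivative F (at x) v)"
      using W(3)[of 1] by auto
    have hd: "(F has_derivative D) (at x) \<longleftrightarrow> (f has_derivative D) (at x)" if "x \<in> S \<inter> W" for x D
      using has_derivative_transform_within_open[OF _ W'(1) that] W(4) by metis
    then have "f differentiable (at p)" using C1(1)[OF W(2)] W'(2) unfolding differentiable_def by blast
    moreover have "continuous_on (S \<inter> W) (\<lambda>x. frechet_derivative f (at x) v)"
      using continuous_on_subset[OF C1(2), of "S \<inter> W"]
      by (rule continuous_on_eq) (use hd in \<open>auto simp: frechet_derivative_def\<close>)
    ultimately show ?thesis using W' continuous_on_eq_continuous_at[OF W'(1)] by auto
  qed
  then show "\<And>x. x \<in> S \<Longrightarrow> (f has_derivative frechet_derivative f (at x)) (at x)"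
    using * frechet_derivative_works by blast
  show "continuous_on S (\<lambda>x. frechet_derivative f (at x) v)"
    using * by (auto intro: continuous_at_imp_continuous_on)
qed

lemma Ck_on_subset:
  assumes "Ck_on k S f" "T \<subseteq> S"
  shows "Ck_on k T f"
  using assms(1)
proof (induction k arbitrary: f)
  case 0
  then show ?case using assms(2) continuous_on_subset by auto
qed (use assms(2) in auto)

text \<open>The scalar \<open>c\<close> yields sums and differences at once; both are required of
  the module of Killing fields.\<close>

lemma Ck_on_add_scaleR:
  assumes "open S" "Ck_on k S f" "Ck_on k S g"
  shows "Ck_on k S (\<lambda>x. f x + c *\<^sub>R g x)"
  using assms(2,3)
proof (induction k arbitrary: f g)
  case 0
  then show ?case by (auto intro!: continuous_intros)
next
  case (Suc k)
  have d: "((\<lambda>x. f x + c *\<^sub>R g x) has_derivative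
      (\<lambda>v. frechet_derivative f (at x) v + c *\<^sub>R frechet_derivative g (at x) v)) (at x)" if "x \<in> S" for x
    using Suc.prems that by (intro has_derivative_add has_derivative_scaleR_right) (auto simp: frechet_derivative_works)
  have "Ck_on k S (\<lambda>x. frechet_derivative (\<lambda>x. f x + c *\<^sub>R g x) (at x) v)" for v
  proof -
    have "Ck_on k S (\<lambda>x. frechet_derivative f (at x) v + c *\<^sub>R frechet_derivative g (at x) v)"
      using Suc.prems by (intro Suc.IH) auto
    then show ?thesis
      by (subst Ck_on_cong[OF assms(1)]) (auto simp: frechet_derivative_eqI[OF d])
  qed
  with d show ?case by (auto simp: differentiable_def)
qed

lemma smooth_on_add_scaleR:
  assumes "smooth_on S f" "smooth_on S g"
  shows "smooth_on S (\<lambda>x. f x + c *\<^sub>R g x)"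
  unfolding smooth_on_def
proof
  fix p assume p: "p \<in> S"
  obtain W F where "open W \<and> p \<in> W \<and> (\<forall>k. Ck_on k W F) \<and> (\<forall>x\<in>S \<inter> W. F x = f x)"
    using bspec[OF assms(1)[unfolded smooth_on_def] p] by (elim exE)
  moreover obtain V G where "open V \<and> p \<in> V \<and> (\<forall>k. Ck_on k V G) \<and> (\<forall>x\<in>S \<inter> V. G x = g x)"
    using bspec[OF assms(2)[unfolded smooth_on_def] p] by (elim exE)
  ultimately have "open (W \<inter> V) \<and> p \<in> W \<inter> V \<and> (\<forall>k. Ck_on k (W \<inter> V) (\<lambda>x. F x + c *\<^sub>R G x)) \<and>
     (\<forall>x\<in>S \<inter> (W \<inter> V). F x + c *\<^sub>R G x = f x + c *\<^sub>R g x)"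
    by (auto intro!: Ck_on_add_scaleR intro: Ck_on_subset)
  then show "\<exists>W F. open W \<and> p \<in> W \<and> (\<forall>k. Ck_on k W F) \<and> (\<forall>x\<in>S \<inter> W. F x = f x + c *\<^sub>R g x)"
    by (intro exI)
qed

lemma smooth_on_cong:
  assumes "\<And>x. x \<in> S \<Longrightarrow> f x = g x"
  shows "smooth_on S f = smooth_on S g"
  unfolding smooth_on_def using assms by simp

section \<open>The boundary circle\<close>

lemma nn_integral_circle_shift:
  fixes \<phi> :: "complex \<Rightarrow> ennreal"
  assumes [measurable]: "(\<lambda>t. \<phi> (cis t)) \<in> borel_measurable borel"
  shows "(\<integral>\<^sup>+t\<in>{2*pi * of_int j..2*pi * of_int j+2*pi}. \<phi> (cis t) \<partial>lborel) = (\<integral>\<^sup>+t\<in>{0..2*pi}. \<phi> (cis t) \<partial>lborel)"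
proof -
  have "cis (2*pi * of_int j + x) = cis x" for x
    by (simp flip: cis_mult)
  moreover have "indicator {2*pi * of_int j..2*pi * of_int j+2*pi} (2*pi * of_int j + x) = (indicator {0..2*pi} x :: ennreal)" for x :: real
    by (auto simp: indicator_def)
  ultimately show ?thesis
    by (subst nn_integral_real_affine[of _ 1 "2*pi * of_int j"]) auto
qed

text \<open>The interval is cut into \<open>K\<close> full turns, each contributing the same by
  periodicity. Closed turns overlap in endpoints, which an upper bound may count twice.\<close>

lemma nn_integral_circle_wrap:
  fixes \<phi> :: "complex \<Rightarrow> ennreal"
  assumes [measurable]: "(\<lambda>t. \<phi> (cis t)) \<in> borel_measurable borel"
  shows "(\<integral>\<^sup>+t\<in>{2*pi * of_int j..2*pi * of_int j+2*pi * of_nat K}. \<phi> (cis t) \<partial>lborel)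
      \<le> of_nat K * (\<integral>\<^sup>+t\<in>{0..2*pi}. \<phi> (cis t) \<partial>lborel)"
proof (induction K)
  case 0
  have "(\<integral>\<^sup>+t\<in>{2*pi * of_int j}. \<phi> (cis t) \<partial>lborel) = 0"
    by (simp add: nn_integral_indicator_singleton')
  then show ?case by simp
next
  case (Suc K)
  let ?a = "2*pi * of_int j" let ?b = "2*pi * of_int (j + int K)"
  have "(\<integral>\<^sup>+t\<in>{?a..?a+2*pi * of_nat (Suc K)}. \<phi> (cis t) \<partial>lborel) \<le>
     (\<integral>\<^sup>+t. \<phi> (cis t) * indicator {?a..?a+2*pi * of_nat K} t + \<phi> (cis t) * indicator {?b..?b+2*pi} t \<partial>lborel)"
    by (intro nn_integral_mono) (auto simp: indicator_def algebra_simps)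
  also have "\<dots> = (\<integral>\<^sup>+t\<in>{?a..?a+2*pi * of_nat K}. \<phi> (cis t) \<partial>lborel) + (\<integral>\<^sup>+t\<in>{?b..?b+2*pi}. \<phi> (cis t) \<partial>lborel)"
    by (intro nn_integral_add) auto
  also have "\<dots> \<le> of_nat K * (\<integral>\<^sup>+t\<in>{0..2*pi}. \<phi> (cis t) \<partial>lborel) + (\<integral>\<^sup>+t\<in>{0..2*pi}. \<phi> (cis t) \<partial>lborel)"
    by (intro add_mono Suc.IH eq_refl nn_integral_circle_shift) auto
  also have "\<dots> = of_nat (Suc K) * (\<integral>\<^sup>+t\<in>{0..2*pi}. \<phi> (cis t) \<partial>lborel)"
    by (simp add: algebra_simps)
  finally show ?case .
qed

text \<open>Inserting the factor \<open>\<alpha>' t / m\<close>, which is at least 1, permits the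
  substitution by \<open>\<alpha>\<close>, whose image of one period is covered by finitely many
  turns. \<open>C\<close> is chosen before \<open>\<phi>\<close>, so the bound is uniform over
  families of integrands.\<close>

lemma nn_integral_circle_reparam:
  fixes \<alpha> \<alpha>' :: "real \<Rightarrow> real"
  assumes deriv: "\<And>t. (\<alpha> has_real_derivative \<alpha>' t) (at t)"
    and cont: "continuous_on UNIV \<alpha>'" and m: "0 < m" "\<And>t. m \<le> \<alpha>' t"
  shows "\<exists>C>0. \<forall>\<phi> :: complex \<Rightarrow> real. (\<lambda>t. \<phi> (cis t)) \<in> borel_measurable borel \<longrightarrow> (\<forall>z. 0 \<le> \<phi> z) \<longrightarrow>
      (\<integral>\<^sup>+t\<in>{0..2*pi}. ennreal (\<phi> (cis (\<alpha> t))) \<partial>lborel) \<le> ennreal C * (\<integral>\<^sup>+t\<in>{0..2*pi}. ennreal (\<phi> (cis t)) \<partial>lborel)"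
proof -
  \<comment> \<open>\<open>\<alpha>\<close> maps the period into the \<open>2 * K\<close> turns that
    start at \<open>- 2 * pi * K\<close>.\<close>
  obtain K where K: "\<bar>\<alpha> 0\<bar> + \<bar>\<alpha> (2*pi)\<bar> \<le> 2 * pi * real K"
    using reals_Archimedean3[of "2*pi"] by (metis less_eq_real_def mult.commute pi_gt_zero zero_less_mult_iff zero_less_numeral)
  have [measurable]: "\<alpha> \<in> borel_measurable borel"
    by (intro borel_measurable_continuous_onI continuous_at_imp_continuous_on) (use deriv DERIV_isCont in blast)
  have [measurable]: "\<alpha>' \<in> borel_measurable borel"
    by (intro borel_measurable_continuous_onI cont)
  show ?thesis
  proof (intro exI conjI allI impI)
    \<comment> \<open>One turn more than needed keeps the constant positive without excluding
      \<open>K = 0\<close>.\<close>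
    show "real (2 * K + 1) / m > 0" using m by simp
    fix \<phi> :: "complex \<Rightarrow> real"
    assume meas[measurable]: "(\<lambda>t. \<phi> (cis t)) \<in> borel_measurable borel" and "\<forall>z. 0 \<le> \<phi> z"
    then have pos: "\<And>z. 0 \<le> \<phi> z" by simp
    have comp[measurable]: "(\<lambda>t. \<phi> (cis (\<alpha> t))) \<in> borel_measurable borel"
      using measurable_compose[OF \<open>\<alpha> \<in> borel_measurable borel\<close> meas] by simp
    let ?I = "\<integral>\<^sup>+t\<in>{0..2*pi}. ennreal (\<phi> (cis t)) \<partial>lborel"
    have "ennreal m * (\<integral>\<^sup>+t\<in>{0..2*pi}. ennreal (\<phi> (cis (\<alpha> t))) \<partial>lborel)
        = (\<integral>\<^sup>+t. ennreal m * (ennreal (\<phi> (cis (\<alpha> t))) * indicator {0..2*pi} t) \<partial>lborel)"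
      by (rule nn_integral_cmult[symmetric]) auto
    also have "\<dots> \<le> (\<integral>\<^sup>+t. ennreal (\<phi> (cis (\<alpha> t)) * \<alpha>' t * indicator {0..2*pi} t) \<partial>lborel)"
      by (intro nn_integral_mono)
         (use m pos in \<open>auto simp: indicator_def mult.commute simp flip: ennreal_mult' intro!: ennreal_leI mult_right_mono\<close>)
    also have "\<dots> = (\<integral>\<^sup>+t. ennreal (\<phi> (cis t) * indicator {\<alpha> 0..\<alpha> (2*pi)} t) \<partial>lborel)"
      by (rule nn_integral_substitution[symmetric])
         (use m deriv cont in \<open>auto simp: set_borel_measurable_def intro: continuous_on_subset order_trans[OF less_imp_le]\<close>)
    also have "\<dots> \<le> (\<integral>\<^sup>+t\<in>{2*pi * of_int (- int K)..2*pi * of_int (- int K)+2*pi * of_nat (2*K)}. ennreal (\<phi> (cis t)) \<partial>lborel)"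
      by (intro nn_integral_mono) (use K in \<open>auto simp: indicator_def\<close>)
    also have "\<dots> \<le> of_nat (2*K) * ?I"
      by (rule nn_integral_circle_wrap) auto
    also have "\<dots> \<le> of_nat (2*K + 1) * ?I"
      by (intro mult_right_mono) auto
    finally have *: "ennreal m * (\<integral>\<^sup>+t\<in>{0..2*pi}. ennreal (\<phi> (cis (\<alpha> t))) \<partial>lborel) \<le> of_nat (2*K + 1) * ?I" .
    have "(\<integral>\<^sup>+t\<in>{0..2*pi}. ennreal (\<phi> (cis (\<alpha> t))) \<partial>lborel)
        = ennreal (1/m) * (ennreal m * (\<integral>\<^sup>+t\<in>{0..2*pi}. ennreal (\<phi> (cis (\<alpha> t))) \<partial>lborel))"
      using m by (simp flip: mult.assoc ennreal_mult')
    also have "\<dots> \<le> ennreal (1/m) * (of_nat (2*K + 1) * ?I)"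
      by (intro mult_left_mono *) simp
    also have "\<dots> = ennreal (1/m) * ennreal (real (2 * K + 1)) * ?I"
      by (simp only: ennreal_of_nat_eq_real_of_nat mult.assoc)
    also have "ennreal (1/m) * ennreal (real (2 * K + 1)) = ennreal (real (2 * K + 1) / m)"
      using m by (subst ennreal_mult'[symmetric]) auto
    finally show "(\<integral>\<^sup>+t\<in>{0..2*pi}. ennreal (\<phi> (cis (\<alpha> t))) \<partial>lborel) \<le> ennreal (real (2 * K + 1) / m) * ?I" .
  qed
qed

section \<open>From the measure on the circle to integrals over one period\<close>

lemma measurable_cis_circle: "cis \<in> borel \<rightarrow>\<^sub>M restrict_space borel (sphere 0 1)"
  by (rule measurable_restrict_space2) (auto intro!: borel_measurable_continuous_onI continuous_intros)

lemma measurable_on_circle: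
  assumes "F \<in> borel_measurable circle_measure"
  shows "(\<lambda>t. F (cis t)) \<in> borel_measurable borel"
proof -
  have "F \<in> borel_measurable (restrict_space borel (sphere 0 1))"
    using assms by (simp add: circle_measure_def)
  from measurable_compose[OF measurable_cis_circle this] show ?thesis .
qed

lemma nn_integral_circle_measure:
  fixes F :: "complex \<Rightarrow> ennreal"
  assumes "F \<in> borel_measurable circle_measure"
  shows "(\<integral>\<^sup>+z. F z \<partial>circle_measure) = (\<integral>\<^sup>+t\<in>{0..2*pi}. F (cis t) \<partial>lborel)"
proof -
  have F: "F \<in> borel_measurable (restrict_space borel (sphere 0 1))"
    using assms by (simp add: circle_measure_def)
  have c: "cis \<in> restrict_space lborel {0..<2*pi} \<rightarrow>\<^sub>M restrict_space borel (sphere 0 1)"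
    by (rule measurable_restrict_space1) (use measurable_cis_circle in simp)
  have "(\<integral>\<^sup>+z. F z \<partial>circle_measure) = (\<integral>\<^sup>+t. F (cis t) \<partial>restrict_space lborel {0..<2*pi})"
    unfolding circle_measure_def by (rule nn_integral_distr[OF c]) (use F in simp)
  also have "\<dots> = (\<integral>\<^sup>+t\<in>{0..<2*pi}. F (cis t) \<partial>lborel)"
    by (rule nn_integral_restrict_space) simp
  also have "\<dots> = (\<integral>\<^sup>+t\<in>{0..2*pi}. F (cis t) \<partial>lborel)"
    by (intro nn_integral_cong_AE eventually_mono[OF AE_lborel_singleton[of "2*pi"]])
       (auto simp: indicator_def)
  finally show ?thesis .
qed

lemma measurable_circle_continuous:
  assumes "continuous_on (sphere 0 1) g"
  shows "g \<in> borel_measurable circle_measure"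
  using borel_measurable_continuous_on_restrict[OF assms] by (simp add: circle_measure_def)

text \<open>The Bochner integral of a non-integrable function is 0 by convention, so the limit in
  \<open>has_L2_extension\<close> becomes a statement about nonnegative integrals only after the
  integrands are shown integrable. The substitution bounds are about nonnegative integrals.\<close>

lemma has_L2_extension_nn_integral:
  assumes "has_L2_extension X Y"
  shows "(\<lambda>t. Y (cis t)) \<in> borel_measurable borel"
    and "(\<integral>\<^sup>+t\<in>{0..2*pi}. ennreal ((cmod (Y (cis t)))\<^sup>2) \<partial>lborel) < \<infinity>"
    and "((\<lambda>\<rho>. \<integral>\<^sup>+t\<in>{0..2*pi}. ennreal ((cmod (X (of_real \<rho> * cis t) - Y (cis t)))\<^sup>2) \<partial>lborel) \<longlongrightarrow> 0) (at_left 1)"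
proof -
  have X: "continuous_on disc X" and Y[measurable]: "Y \<in> borel_measurable circle_measure"
    and Y2: "integrable circle_measure (\<lambda>z. (cmod (Y z))\<^sup>2)"
    and lim: "((\<lambda>\<epsilon>. LINT z|circle_measure. (cmod (X (complex_of_real (1 - \<epsilon>) * z) - Y z))\<^sup>2) \<longlongrightarrow> 0) (at_right 0)"
    using assms by (auto simp: has_L2_extension_def L2_on_circle_def)
  show "(\<lambda>t. Y (cis t)) \<in> borel_measurable borel" by (rule measurable_on_circle[OF Y])
  have space: "space circle_measure = sphere 0 1"
    by (simp add: circle_measure_def space_restrict_space)
  have Y2fin: "(\<integral>\<^sup>+z. ennreal ((cmod (Y z))\<^sup>2) \<partial>circle_measure) < \<infinity>"
    using Y2 by (simp add: integrable_iff_bounded)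
  then show "(\<integral>\<^sup>+t\<in>{0..2*pi}. ennreal ((cmod (Y (cis t)))\<^sup>2) \<partial>lborel) < \<infinity>"
    by (subst (asm) nn_integral_circle_measure) auto
  have fin: "finite_measure circle_measure"
  proof
    have "emeasure circle_measure (space circle_measure) = (\<integral>\<^sup>+z. 1 \<partial>circle_measure)" by simp
    also have "\<dots> = (\<integral>\<^sup>+t\<in>{0..2*pi}. 1 \<partial>lborel)" by (rule nn_integral_circle_measure) simp
    finally show "emeasure circle_measure (space circle_measure) \<noteq> \<infinity>" by simp
  qed
  have eq: "(\<integral>\<^sup>+t\<in>{0..2*pi}. ennreal ((cmod (X (of_real \<rho> * cis t) - Y (cis t)))\<^sup>2) \<partial>lborel)
      = ennreal (LINT z|circle_measure. (cmod (X (of_real \<rho> * z) - Y z))\<^sup>2)"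
    if \<rho>: "0 < \<rho>" "\<rho> < 1" for \<rho> :: real
  proof -
    have cont: "continuous_on (sphere 0 1) (\<lambda>z. X (of_real \<rho> * z))"
      by (rule continuous_on_compose2[OF X]) (use \<rho> in \<open>auto intro!: continuous_intros simp: norm_mult\<close>)
    then have [measurable]: "(\<lambda>z. X (of_real \<rho> * z)) \<in> borel_measurable circle_measure"
      by (rule measurable_circle_continuous)
    have "bounded ((\<lambda>z. X (of_real \<rho> * z)) ` sphere 0 1)"
      by (intro compact_imp_bounded compact_continuous_image cont) simp
    then obtain B where B: "\<And>z. z \<in> sphere 0 1 \<Longrightarrow> cmod (X (of_real \<rho> * z)) \<le> B"
      unfolding bounded_iff by (auto simp del: mem_sphere_0 mem_sphere)
    \<comment> \<open>This dominating function comes from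
      \<open>(x + y)\<^sup>2 \<le> 2 * x\<^sup>2 + 2 * y\<^sup>2\<close>; its constant term is
      integrable as the circle has finite measure.\<close>
    have "integrable circle_measure (\<lambda>z. 2 * B\<^sup>2 + 2 * (cmod (Y z))\<^sup>2)"
      by (intro Bochner_Integration.integrable_add finite_measure.integrable_const[OF fin] integrable_mult_right Y2)
    then have "integrable circle_measure (\<lambda>z. (cmod (X (of_real \<rho> * z) - Y z))\<^sup>2)"
    proof (rule Bochner_Integration.integrable_bound)
      show "AE z in circle_measure. norm ((cmod (X (of_real \<rho> * z) - Y z))\<^sup>2) \<le> norm (2 * B\<^sup>2 + 2 * (cmod (Y z))\<^sup>2)"
      proof (rule AE_I2)
        fix z assume "z \<in> space circle_measure"
        then have "cmod (X (of_real \<rho> * z)) \<le> B" using B space by auto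
        then have "(cmod (X (of_real \<rho> * z) - Y z))\<^sup>2 \<le> (B + cmod (Y z))\<^sup>2"
          by (intro power_mono) (use norm_triangle_ineq4[of "X (of_real \<rho> * z)" "Y z"] in auto)
        also have "\<dots> \<le> 2 * B\<^sup>2 + 2 * (cmod (Y z))\<^sup>2"
          using sum_squares_bound[of B "cmod (Y z)"] by (simp add: power2_sum)
        finally show "norm ((cmod (X (of_real \<rho> * z) - Y z))\<^sup>2) \<le> norm (2 * B\<^sup>2 + 2 * (cmod (Y z))\<^sup>2)"
          by simp
      qed
    qed auto
    then have "ennreal (LINT z|circle_measure. (cmod (X (of_real \<rho> * z) - Y z))\<^sup>2) =
       (\<integral>\<^sup>+z. ennreal ((cmod (X (of_real \<rho> * z) - Y z))\<^sup>2) \<partial>circle_measure)"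
      by (subst nn_integral_eq_integral) auto
    also have "\<dots> = (\<integral>\<^sup>+t\<in>{0..2*pi}. ennreal ((cmod (X (of_real \<rho> * cis t) - Y (cis t)))\<^sup>2) \<partial>lborel)"
      by (rule nn_integral_circle_measure) auto
    finally show ?thesis ..
  qed
  have "((\<lambda>\<rho>. LINT z|circle_measure. (cmod (X (of_real \<rho> * z) - Y z))\<^sup>2) \<longlongrightarrow> 0) (at_left 1)"
  proof -
    have "filterlim (\<lambda>\<rho>::real. 1 - \<rho>) (at_right 0) (at_left 1)"
      unfolding filterlim_at
      by (auto intro!: tendsto_eq_intros simp: eventually_at_filter)
    from filterlim_compose[OF lim this] show ?thesis by simp
  qed
  then have "((\<lambda>\<rho>. ennreal (LINT z|circle_measure. (cmod (X (of_real \<rho> * z) - Y z))\<^sup>2)) \<longlongrightarrow> ennreal 0) (at_left 1)"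
    by (rule tendsto_ennrealI)
  then have "((\<lambda>\<rho>. ennreal (LINT z|circle_measure. (cmod (X (of_real \<rho> * z) - Y z))\<^sup>2)) \<longlongrightarrow> 0) (at_left 1)"
    by simp
  then show "((\<lambda>\<rho>. \<integral>\<^sup>+t\<in>{0..2*pi}. ennreal ((cmod (X (of_real \<rho> * cis t) - Y (cis t)))\<^sup>2) \<partial>lborel) \<longlongrightarrow> 0) (at_left 1)"
    by (rule Lim_transform_eventually)
       (use eventually_at_left_real[of 0 1] in \<open>auto elim!: eventually_mono simp: eq\<close>)
qed

text \<open>Over a bounded interval L2 implies L1, through \<open>y \<le> 1 + y\<^sup>2\<close>.
  Assumption \<open>C\<close> carries the L2 bound from \<open>Y (cis t)\<close> to
  \<open>Y (cis (\<alpha> t))\<close>.\<close>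

lemma L2_circle_reparam_integrable:
  fixes \<alpha> :: "real \<Rightarrow> real" and Y :: "complex \<Rightarrow> complex" and k :: "real \<Rightarrow> complex"
  assumes Y: "(\<lambda>t. Y (cis t)) \<in> borel_measurable borel"
    and Y2: "(\<integral>\<^sup>+t\<in>{0..2*pi}. ennreal ((cmod (Y (cis t)))\<^sup>2) \<partial>lborel) < \<infinity>"
    and \<alpha>: "\<alpha> \<in> borel_measurable borel"
    and C: "\<And>\<phi> :: complex \<Rightarrow> real. (\<lambda>t. \<phi> (cis t)) \<in> borel_measurable borel \<Longrightarrow> (\<And>z. 0 \<le> \<phi> z) \<Longrightarrow>
      (\<integral>\<^sup>+t\<in>{0..2*pi}. ennreal (\<phi> (cis (\<alpha> t))) \<partial>lborel) \<le> ennreal C * (\<integral>\<^sup>+t\<in>{0..2*pi}. ennreal (\<phi> (cis t)) \<partial>lborel)"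
    and k: "continuous_on {0..2*pi} k"
  shows "set_integrable lborel {0..2*pi} (\<lambda>t. Y (cis (\<alpha> t)) * k t)"
proof -
  have Ya[measurable]: "(\<lambda>t. Y (cis (\<alpha> t))) \<in> borel_measurable borel"
    using measurable_compose[OF \<alpha> Y] by simp
  \<comment> \<open>\<open>k\<close> is continuous on the period only, so it is cut off there to
    obtain a Borel function on the line.\<close>
  have k1[measurable]: "(\<lambda>t. indicator {0..2*pi} t *\<^sub>R k t) \<in> borel_measurable borel"
    using k by (intro borel_measurable_continuous_on_indicator) auto
  have "bounded (k ` {0..2*pi})"
    by (intro compact_imp_bounded compact_continuous_image k) simp
  then obtain B where B: "\<And>t. t \<in> {0..2*pi} \<Longrightarrow> cmod (k t) \<le> B"
    unfolding bounded_iff by blast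
  have B0: "0 \<le> B" using B[of 0] norm_ge_zero[of "k 0"] by (simp del: norm_ge_zero)
  have fin2: "(\<integral>\<^sup>+t\<in>{0..2*pi}. ennreal ((cmod (Y (cis (\<alpha> t))))\<^sup>2) \<partial>lborel) < \<infinity>"
    using C[of "\<lambda>z. (cmod (Y z))\<^sup>2"] Y Y2 by (auto simp: ennreal_mult_less_top elim!: le_less_trans)
  have meas: "(\<lambda>t. Y (cis (\<alpha> t)) * (indicator {0..2*pi} t *\<^sub>R k t)) \<in> borel_measurable lborel"
    by (intro borel_measurable_times) auto
  have "integrable lborel (\<lambda>t. Y (cis (\<alpha> t)) * (indicator {0..2*pi} t *\<^sub>R k t))"
    unfolding integrable_iff_bounded
  proof
    have "(\<integral>\<^sup>+t. ennreal (norm (Y (cis (\<alpha> t)) * (indicator {0..2*pi} t *\<^sub>R k t))) \<partial>lborel)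
       \<le> (\<integral>\<^sup>+t. ennreal B * indicator {0..2*pi} t + ennreal B * (ennreal ((cmod (Y (cis (\<alpha> t))))\<^sup>2) * indicator {0..2*pi} t) \<partial>lborel)"
    proof (intro nn_integral_mono)
      fix t :: real
      let ?y = "cmod (Y (cis (\<alpha> t)))"
      show "ennreal (norm (Y (cis (\<alpha> t)) * (indicator {0..2*pi} t *\<^sub>R k t))) \<le>
        ennreal B * indicator {0..2*pi} t + ennreal B * (ennreal (?y\<^sup>2) * indicator {0..2*pi} t)"
      proof (cases "t \<in> {0..2*pi}")
        case True
        have "?y \<le> 1 + ?y\<^sup>2"
          using zero_le_power2[of "?y - 1"] by (simp add: power2_diff power2_eq_square algebra_simps) (smt (verit) norm_ge_zero)
        then have "?y * cmod (k t) \<le> (1 + ?y\<^sup>2) * B"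
          using B[OF True] by (intro mult_mono) auto
        then show ?thesis
          using True B0 by (simp add: norm_mult algebra_simps ennreal_leI flip: ennreal_plus ennreal_mult')
      qed auto
    qed
    also have "\<dots> = ennreal B * ennreal (2*pi) + ennreal B * (\<integral>\<^sup>+t\<in>{0..2*pi}. ennreal ((cmod (Y (cis (\<alpha> t))))\<^sup>2) \<partial>lborel)"
      by (simp add: nn_integral_add nn_integral_cmult nn_integral_cmult_indicator)
    also have "\<dots> < \<infinity>"
      using fin2 by (simp add: ennreal_mult_less_top)
    finally show "(\<integral>\<^sup>+t. ennreal (norm (Y (cis (\<alpha> t)) * (indicator {0..2*pi} t *\<^sub>R k t))) \<partial>lborel) < \<infinity>" .
  qed (rule meas)
  then show ?thesis
    unfolding set_integrable_def by (simp add: mult.commute mult_ac)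
qed

text \<open>The substitution bound is applied to the squared L2 error at radius \<rho>, with a
  constant independent of \<rho>; convergence in L2 thus survives the reparametrisation and implies
  convergence of the integrals against \<open>k\<close>.\<close>

lemma tendsto_circle_reparam:
  fixes \<alpha> :: "real \<Rightarrow> real" and X Y :: "complex \<Rightarrow> complex" and k :: "real \<Rightarrow> complex"
  assumes XY: "has_L2_extension X Y"
    and deriv: "\<And>t. (\<alpha> has_real_derivative \<alpha>' t) (at t)"
    and cont: "continuous_on UNIV \<alpha>'" and m: "0 < m" "\<And>t. m \<le> \<alpha>' t"
    and k: "continuous_on {0..2*pi} k"
  shows "((\<lambda>\<rho>. integral {0..2*pi} (\<lambda>t. X (of_real \<rho> * cis (\<alpha> t)) * k t)) \<longlongrightarrow>
     (LBINT t:{0..2*pi}. Y (cis (\<alpha> t)) * k t)) (at_left 1)"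
proof (rule tendstoI)
  fix e :: real assume e: "e > 0"
  have X: "continuous_on disc X" using XY by (simp add: has_L2_extension_def)
  note Ymeas[measurable] = has_L2_extension_nn_integral(1)[OF XY]
  note Y2 = has_L2_extension_nn_integral(2)[OF XY]
  obtain C :: real where C: "C > 0"
    "\<And>\<phi> :: complex \<Rightarrow> real. (\<lambda>t. \<phi> (cis t)) \<in> borel_measurable borel \<Longrightarrow> (\<And>z. 0 \<le> \<phi> z) \<Longrightarrow>
      (\<integral>\<^sup>+t\<in>{0..2*pi}. ennreal (\<phi> (cis (\<alpha> t))) \<partial>lborel) \<le> ennreal C * (\<integral>\<^sup>+t\<in>{0..2*pi}. ennreal (\<phi> (cis t)) \<partial>lborel)"
    using nn_integral_circle_reparam[OF deriv cont m] by (elim exE conjE) auto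
  have conta: "continuous_on S \<alpha>" for S
    by (intro continuous_at_imp_continuous_on) (use deriv DERIV_isCont in blast)
  have ameas[measurable]: "\<alpha> \<in> borel_measurable borel"
    by (intro borel_measurable_continuous_onI conta)
  have Ya[measurable]: "(\<lambda>t. Y (cis (\<alpha> t))) \<in> borel_measurable borel"
    using measurable_compose[OF ameas Ymeas] by simp
  have "bounded (k ` {0..2*pi})"
    by (intro compact_imp_bounded compact_continuous_image k) simp
  then obtain B0 where B0: "\<And>t. t \<in> {0..2*pi} \<Longrightarrow> cmod (k t) \<le> B0"
    unfolding bounded_iff by blast
  define B where "B = max B0 1"
  have B: "B > 0" "\<And>t. t \<in> {0..2*pi} \<Longrightarrow> cmod (k t) \<le> B"
    using B0 by (force simp: B_def)+
  \<comment> \<open>The integral of \<open>|u k|\<close> will be at most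
    \<open>B * \<delta> * 2 * pi + (B / \<delta>) * (C * \<eta>)\<close>. The choices make each of
    the two terms equal to \<open>e / 4\<close>.\<close>
  define \<delta> where "\<delta> = e / (8 * pi * B)"
  define \<eta> where "\<eta> = e * \<delta> / (4 * B * C)"
  have pos: "\<delta> > 0" "\<eta> > 0" using e B C by (auto simp: \<delta>_def \<eta>_def)
  have "\<forall>\<^sub>F \<rho> in at_left 1. (\<integral>\<^sup>+t\<in>{0..2*pi}. ennreal ((cmod (X (of_real \<rho> * cis t) - Y (cis t)))\<^sup>2) \<partial>lborel) < ennreal \<eta>"
    using has_L2_extension_nn_integral(3)[OF XY] pos by (intro order_tendstoD) auto
  then show "\<forall>\<^sub>F \<rho> in at_left 1. dist (integral {0..2*pi} (\<lambda>t. X (of_real \<rho> * cis (\<alpha> t)) * k t))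
     (LBINT t:{0..2*pi}. Y (cis (\<alpha> t)) * k t) < e"
    using eventually_at_left_real[of 0 1, simplified]
  proof eventually_elim
    case (elim \<rho>)
    have rho: "0 < \<rho>" "\<rho> < 1" using elim(2) by auto
    have contX: "continuous_on UNIV (\<lambda>t. X (of_real \<rho> * cis t))"
      by (rule continuous_on_compose2[OF X]) (use rho in \<open>auto intro!: continuous_intros simp: norm_mult\<close>)
    then have Xm[measurable]: "(\<lambda>t. X (of_real \<rho> * cis t)) \<in> borel_measurable borel"
      by (rule borel_measurable_continuous_onI)
    have contXa: "continuous_on {0..2*pi} (\<lambda>t. X (of_real \<rho> * cis (\<alpha> t)))"
      by (rule continuous_on_compose2[OF contX conta]) auto
    have Xi: "set_integrable lborel {0..2*pi} (\<lambda>t. X (of_real \<rho> * cis (\<alpha> t)) * k t)"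
      by (intro borel_integrable_atLeastAtMost' continuous_on_mult contXa k)
    have Yi: "set_integrable lborel {0..2*pi} (\<lambda>t. Y (cis (\<alpha> t)) * k t)"
      by (rule L2_circle_reparam_integrable[OF Ymeas Y2 ameas C(2) k])
    define u where "u = (\<lambda>t. X (of_real \<rho> * cis (\<alpha> t)) - Y (cis (\<alpha> t)))"
    have um[measurable]: "u \<in> borel_measurable borel"
      unfolding u_def using measurable_compose[OF ameas Xm] by auto
    have Ui: "set_integrable lborel {0..2*pi} (\<lambda>t. u t * k t)"
      using set_integral_diff(1)[OF Xi Yi] by (simp add: u_def algebra_simps)
    have N: "(\<integral>\<^sup>+t\<in>{0..2*pi}. ennreal ((cmod (u t))\<^sup>2) \<partial>lborel) \<le> ennreal (C * \<eta>)"
    proof -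
      have "(\<integral>\<^sup>+t\<in>{0..2*pi}. ennreal ((cmod (u t))\<^sup>2) \<partial>lborel) \<le>
        ennreal C * (\<integral>\<^sup>+t\<in>{0..2*pi}. ennreal ((cmod (X (of_real \<rho> * cis t) - Y (cis t)))\<^sup>2) \<partial>lborel)"
        unfolding u_def by (rule C(2)[of "\<lambda>z. (cmod (X (of_real \<rho> * z) - Y z))\<^sup>2"]) auto
      also have "\<dots> \<le> ennreal C * ennreal \<eta>"
        using elim(1) by (intro mult_left_mono) auto
      finally show ?thesis using C pos by (simp add: ennreal_mult')
    qed
    have "integral {0..2*pi} (\<lambda>t. X (of_real \<rho> * cis (\<alpha> t)) * k t) - (LBINT t:{0..2*pi}. Y (cis (\<alpha> t)) * k t)
       = (LBINT t:{0..2*pi}. u t * k t)"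
      using set_integral_diff(2)[OF Xi Yi] set_borel_integral_eq_integral(2)[OF Xi]
      by (simp add: u_def algebra_simps)
    then have "ennreal (dist (integral {0..2*pi} (\<lambda>t. X (of_real \<rho> * cis (\<alpha> t)) * k t))
       (LBINT t:{0..2*pi}. Y (cis (\<alpha> t)) * k t)) = ennreal (norm (LBINT t:{0..2*pi}. u t * k t))"
      by (simp add: dist_norm)
    also have "\<dots> \<le> (\<integral>\<^sup>+t. ennreal (norm (indicator {0..2*pi} t *\<^sub>R (u t * k t))) \<partial>lborel)"
      using Ui unfolding set_lebesgue_integral_def set_integrable_def by (rule integral_norm_bound_ennreal)
    also have "\<dots> \<le> (\<integral>\<^sup>+t. ennreal (B * \<delta>) * indicator {0..2*pi} t + ennreal (B / \<delta>) * (ennreal ((cmod (u t))\<^sup>2) * indicator {0..2*pi} t) \<partial>lborel)"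
    proof (intro nn_integral_mono)
      fix t :: real
      show "ennreal (norm (indicator {0..2*pi} t *\<^sub>R (u t * k t))) \<le>
         ennreal (B * \<delta>) * indicator {0..2*pi} t + ennreal (B / \<delta>) * (ennreal ((cmod (u t))\<^sup>2) * indicator {0..2*pi} t)"
      proof (cases "t \<in> {0..2*pi}")
        case True
        \<comment> \<open>The square expands to
          \<open>|u|\<^sup>2 - |u| * \<delta> + \<delta>\<^sup>2\<close> together with the added
          term; divided by \<open>\<delta>\<close> this bounds \<open>|u|\<close> by a constant and
          a square, in place of the Cauchy-Schwarz inequality.\<close>
        have "0 \<le> (cmod (u t) - \<delta>)\<^sup>2 + cmod (u t) * \<delta>" using pos by simp
        then have "cmod (u t) \<le> \<delta> + (cmod (u t))\<^sup>2 / \<delta>"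
          using pos by (simp add: field_simps power2_eq_square)
        then have "cmod (u t) * cmod (k t) \<le> (\<delta> + (cmod (u t))\<^sup>2 / \<delta>) * B"
          using B(2)[OF True] by (intro mult_mono) (use pos in auto)
        also have "\<dots> = B * \<delta> + B / \<delta> * (cmod (u t))\<^sup>2" by (simp add: field_simps)
        finally have "ennreal (cmod (u t) * cmod (k t)) \<le> ennreal (B * \<delta> + B / \<delta> * (cmod (u t))\<^sup>2)"
          by (rule ennreal_leI)
        also have "\<dots> = ennreal (B * \<delta>) + ennreal (B / \<delta>) * ennreal ((cmod (u t))\<^sup>2)"
          using B pos by (simp only: ennreal_mult'[symmetric] ennreal_plus[symmetric] less_imp_le mult_nonneg_nonneg divide_nonneg_nonneg zero_le_power2 simp_thms)
        finally show ?thesis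
          using True by (simp add: norm_mult)
      qed auto
    qed
    also have "\<dots> = ennreal (B * \<delta>) * ennreal (2*pi) + ennreal (B / \<delta>) * (\<integral>\<^sup>+t\<in>{0..2*pi}. ennreal ((cmod (u t))\<^sup>2) \<partial>lborel)"
      by (simp add: nn_integral_add nn_integral_cmult nn_integral_cmult_indicator)
    also have "\<dots> \<le> ennreal (B * \<delta>) * ennreal (2*pi) + ennreal (B / \<delta>) * ennreal (C * \<eta>)"
      by (intro add_left_mono mult_left_mono N) auto
    also have "\<dots> = ennreal (B * \<delta> * (2 * pi) + B / \<delta> * (C * \<eta>))"
      using B(1) pos C(1) by (simp only: ennreal_mult'[symmetric] ennreal_plus[symmetric] less_imp_le mult_nonneg_nonneg divide_nonneg_nonneg pi_ge_zero zero_le_numeral simp_thms)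
    also have "B * \<delta> * (2 * pi) + B / \<delta> * (C * \<eta>) = e / 2"
      using B pos(1) C by (simp add: \<eta>_def) (simp add: \<delta>_def field_simps)
    finally show ?case using e by (simp add: ennreal_le_iff)
  qed
qed

text \<open>The field \<open>\<xi>\<close> converges along concentric circles, which \<open>\<gamma>\<close> does not preserve. For \<open>\<rho> < 1\<close> the
  function \<open>\<xi> (\<rho> \<gamma> z) k z\<close> is of class C1 up to the boundary, and its integrals over \<open>|z| = 1\<close> and
  \<open>|z| = s\<close> differ by \<open>O(1 - s)\<close> uniformly in \<open>\<rho>\<close>. Let first \<open>\<rho>\<close> and then \<open>s\<close> tend to 1.\<close>

lemma tendsto_dbar_bounded_boundary:
  fixes \<xi> Y \<gamma> k :: "complex \<Rightarrow> complex" and D :: "complex \<Rightarrow> complex \<Rightarrow> complex"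
  assumes der: "\<And>z. z \<in> disc \<Longrightarrow> (\<xi> has_derivative D z) (at z)"
    and contD: "\<And>v. continuous_on disc (\<lambda>z. D z v)"
    and M: "\<And>z. z \<in> disc \<Longrightarrow> cmod (D z 1 + \<i> * D z \<i>) \<le> M"
    and XY: "has_L2_extension \<xi> Y"
    and U: "open U" "{z. 1/2 \<le> cmod z \<and> cmod z \<le> 1} \<subseteq> U"
    and \<gamma>: "\<gamma> holomorphic_on U" and k: "k holomorphic_on U"
    and \<gamma>1: "\<And>z. z \<in> U \<Longrightarrow> cmod z < 1 \<Longrightarrow> cmod (\<gamma> z) < 1"
    and \<alpha>: "\<And>t. \<gamma> (cis t) = cis (\<alpha> t)"
    and deriv: "\<And>t. (\<alpha> has_real_derivative \<alpha>' t) (at t)"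
    and cont: "continuous_on UNIV \<alpha>'" and m: "0 < m" "\<And>t. m \<le> \<alpha>' t"
  shows "((\<lambda>s. integral {0..2*pi} (\<lambda>t. \<xi> (\<gamma> (of_real s * cis t)) * k (of_real s * cis t) * (of_real s * cis t))) \<longlongrightarrow>
     (LBINT t:{0..2*pi}. Y (cis (\<alpha> t)) * (k (cis t) * cis t))) (at_left 1)"
proof -
  \<comment> \<open>An annulus leaves room for a pole of \<open>k\<close> at the origin, which
    occurs when \<open>k\<close> contains a negative power of z.\<close>
  let ?A = "{z. 1/2 \<le> cmod z \<and> cmod z \<le> 1}"
  have "?A = cball 0 1 - ball 0 (1/2)" by auto
  then have comp: "compact ?A" by (simp add: compact_diff)
  have cont\<gamma>: "continuous_on ?A \<gamma>" and contk: "continuous_on ?A k"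
    using \<gamma> k U(2) by (meson continuous_on_subset holomorphic_on_imp_continuous_on)+
  have cont\<gamma>': "continuous_on ?A (deriv \<gamma>)" and contk': "continuous_on ?A (deriv k)"
    using \<gamma> k U by (meson continuous_on_subset holomorphic_deriv holomorphic_on_imp_continuous_on)+
  have \<gamma>le: "cmod (\<gamma> z) \<le> 1" if "z \<in> ?A" for z
  proof (cases "cmod z = 1")
    case True
    then have "z = cis (Arg z)" using cis_Arg[of z] by (force simp: sgn_div_norm)
    then show ?thesis using \<alpha>[of "Arg z"] by (metis norm_cis order.refl)
  qed (use \<gamma>1[of z] that U(2) in auto)
  have "bounded (k ` ?A)" "bounded (deriv \<gamma> ` ?A)"
    by (intro compact_imp_bounded compact_continuous_image comp contk cont\<gamma>')+
  then obtain Bk B\<gamma> where B: "\<And>z. z \<in> ?A \<Longrightarrow> cmod (k z) \<le> Bk" "\<And>z. z \<in> ?A \<Longrightarrow> cmod (deriv \<gamma> z) \<le> B\<gamma>"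
    unfolding bounded_iff by blast
  have B0: "0 \<le> Bk" "0 \<le> B\<gamma>" "0 \<le> M"
    using order_trans[OF norm_ge_zero B(1)[of 1]] order_trans[OF norm_ge_zero B(2)[of 1]] order_trans[OF norm_ge_zero M[of 0]] by auto
  \<comment> \<open>As \<open>\<gamma>\<close> and \<open>k\<close> are holomorphic, d-bar of
    \<open>\<xi> (\<rho> * \<gamma> z) * k z\<close> is d-bar of \<open>\<xi>\<close> at
    \<open>\<rho> * \<gamma> z\<close> times \<open>k z\<close> and the conjugate of
    \<open>\<rho> * deriv \<gamma> z\<close>. Hence the bound depends neither on \<rho> nor on the
    derivative of \<open>k\<close>.\<close>
  define M' where "M' = Bk * B\<gamma> * M"
  define I where "I = (\<lambda>\<rho> s. integral {0..2*pi} (\<lambda>t. \<xi> (of_real \<rho> * \<gamma> (of_real s * cis t)) * k (of_real s * cis t) * (of_real s * cis t)))"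
  define J where "J = (LBINT t:{0..2*pi}. Y (cis (\<alpha> t)) * (k (cis t) * cis t))"
  have cont\<xi>: "continuous_on disc \<xi>"
    using der by (auto intro!: continuous_at_imp_continuous_on has_derivative_continuous)
  have cisA: "cis t \<in> ?A" for t by simp
  have Jlim: "((\<lambda>\<rho>. I \<rho> 1) \<longlongrightarrow> J) (at_left 1)"
  proof -
    have "continuous_on {0..2*pi} (\<lambda>t. k (cis t) * cis t)"
      by (intro continuous_intros continuous_on_compose2[OF contk]) auto
    from tendsto_circle_reparam[OF XY deriv cont m this] show ?thesis
      by (simp add: I_def J_def \<alpha> mult.assoc)
  qed
  have diff: "cmod (I \<rho> 1 - I \<rho> s) \<le> 2 * pi * M' * (1 - s)"
    if \<rho>: "0 < \<rho>" "\<rho> < 1" and s: "1/2 \<le> s" "s < 1" for \<rho> s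
  proof -
    let ?w = "\<lambda>z. of_real \<rho> * \<gamma> z"
    have w: "?w z \<in> disc" if "z \<in> ?A" for z
      using \<gamma>le[OF that] \<rho> by (auto simp: norm_mult intro: le_less_trans[OF mult_left_le])
    define E where "E = (\<lambda>z v. D (?w z) (of_real \<rho> * deriv \<gamma> z * v) * k z + \<xi> (?w z) * (deriv k z * v))"
    have "cmod (integral {0..2*pi} (\<lambda>t. (\<xi> (?w (cis t)) * k (cis t)) * cis t) -
           integral {0..2*pi} (\<lambda>t. (\<xi> (?w (of_real s * cis t)) * k (of_real s * cis t)) * (of_real s * cis t))) \<le> 2 * pi * M' * (1 - s)"
    proof (rule circle_integral_dbar_bound[where D = E])
      fix z assume "s \<le> cmod z" "cmod z \<le> 1"
      then have z: "z \<in> ?A" using s by auto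
      then have zU: "z \<in> U" using U by auto
      have dk: "(k has_derivative (\<lambda>v. deriv k z * v)) (at z)"
        using holomorphic_derivI[OF k U(1) zU] by (simp add: has_field_derivative_def)
      have dw: "(?w has_derivative (\<lambda>v. of_real \<rho> * deriv \<gamma> z * v)) (at z)"
        using DERIV_cmult[OF holomorphic_derivI[OF \<gamma> U(1) zU], of "of_real \<rho>"] by (simp add: has_field_derivative_def)
      have d\<xi>: "((\<lambda>z. \<xi> (?w z)) has_derivative (\<lambda>v. D (?w z) (of_real \<rho> * deriv \<gamma> z * v))) (at z)"
        by (rule has_derivative_compose[OF dw der[OF w[OF z]]])
      show "((\<lambda>z. \<xi> (?w z) * k z) has_derivative E z) (at z)"
        unfolding E_def using has_derivative_mult[OF d\<xi> dk] by (simp add: add.commute)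
      have lin: "linear (D (?w z))" using der[OF w[OF z]] has_derivative_linear by blast
      have "E z 1 + \<i> * E z \<i> = k z * (D (?w z) (of_real \<rho> * deriv \<gamma> z) + \<i> * D (?w z) (\<i> * (of_real \<rho> * deriv \<gamma> z)))"
        by (simp add: E_def algebra_simps)
      also have "\<dots> = k z * (cnj (of_real \<rho> * deriv \<gamma> z) * (D (?w z) 1 + \<i> * D (?w z) \<i>))"
        by (simp only: dbar_rotate[OF lin])
      finally have "cmod (E z 1 + \<i> * E z \<i>) = cmod (k z) * (\<rho> * cmod (deriv \<gamma> z)) * cmod (D (?w z) 1 + \<i> * D (?w z) \<i>)"
        using \<rho> by (simp add: norm_mult)
      also have "\<dots> \<le> Bk * (1 * B\<gamma>) * M"
        by (intro mult_mono B z M[OF w] mult_nonneg_nonneg) (use \<rho> B0 in auto)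
      finally show "cmod (E z 1 + \<i> * E z \<i>) \<le> M'" by (simp add: M'_def)
    next
      have sub: "{z. s \<le> cmod z \<and> cmod z \<le> 1} \<subseteq> ?A" using s by auto
      have cw: "continuous_on ?A ?w" by (intro continuous_intros cont\<gamma>)
      have cE: "continuous_on ?A (\<lambda>z. E z v)" for v
      proof -
        let ?v = "\<lambda>z. of_real \<rho> * deriv \<gamma> z * v"
        have "continuous_on ?A (\<lambda>z. (of_real (Re (?v z)) * D (?w z) 1 + of_real (Im (?v z)) * D (?w z) \<i>) * k z + \<xi> (?w z) * (deriv k z * v))"
          by (intro continuous_intros cont\<gamma>' contk contk' continuous_on_compose2[OF contD cw]
                continuous_on_compose2[OF cont\<xi> cw]) (use w in auto)
        then show ?thesis
        proof (rule continuous_on_eq)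
          fix z assume z: "z \<in> ?A"
          have lin: "linear (D (?w z))" using der[OF w[OF z]] has_derivative_linear by blast
          show "(of_real (Re (?v z)) * D (?w z) 1 + of_real (Im (?v z)) * D (?w z) \<i>) * k z + \<xi> (?w z) * (deriv k z * v) = E z v"
            unfolding E_def by (subst real_linear_complex_eq[OF lin, of "?v z"]) simp
        qed
      qed
      show "continuous_on {z. s \<le> cmod z \<and> cmod z \<le> 1} (\<lambda>z. E z 1)"
        "continuous_on {z. s \<le> cmod z \<and> cmod z \<le> 1} (\<lambda>z. E z \<i>)"
        using cE sub continuous_on_subset by blast+
    qed (use s in auto)
    then show ?thesis by (simp add: I_def)
  qed
  \<comment> \<open>For fixed \<open>s < 1\<close> the value \<rho> = 1 is harmless:
    \<open>\<gamma>\<close> maps the circle of radius \<open>s\<close> into the open disc, so the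
    integrand is jointly continuous on the closed parameter range.\<close>
  have Ilim: "((\<lambda>\<rho>. I \<rho> s) \<longlongrightarrow> I 1 s) (at_left 1)" if s: "1/2 \<le> s" "s < 1" for s
  proof -
    have sA: "of_real s * cis t \<in> ?A" for t using s by (simp add: norm_mult)
    have g: "cmod (\<gamma> (of_real s * cis t)) < 1" for t
      using \<gamma>1[OF subsetD[OF U(2) sA]] s by (auto simp: norm_mult)
    have g': "x * cmod (\<gamma> (of_real s * cis t)) < 1" if "0 \<le> x" "x \<le> 1" for x t
      using mult_left_le_one_le[OF norm_ge_zero that, of "\<gamma> (of_real s * cis t)"] g[of t] by linarith
    have c: "continuous_on ({0..1} \<times> cbox 0 (2*pi)) (\<lambda>(\<rho>,t). \<xi> (of_real \<rho> * \<gamma> (of_real s * cis t)) * k (of_real s * cis t) * (of_real s * cis t))"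
      unfolding case_prod_beta
    proof (intro continuous_intros)
      have c\<gamma>: "continuous_on ({0..1} \<times> cbox 0 (2*pi)) (\<lambda>x::real\<times>real. \<gamma> (of_real s * cis (snd x)))"
        by (rule continuous_on_compose2[OF cont\<gamma>]) (use sA in \<open>auto intro!: continuous_intros\<close>)
      show "continuous_on ({0..1} \<times> cbox 0 (2*pi)) (\<lambda>x::real\<times>real. k (of_real s * cis (snd x)))"
        by (rule continuous_on_compose2[OF contk]) (use sA in \<open>auto intro!: continuous_intros\<close>)
      show "continuous_on ({0..1} \<times> cbox 0 (2*pi)) (\<lambda>x::real\<times>real. \<xi> (of_real (fst x) * \<gamma> (of_real s * cis (snd x))))"
        by (rule continuous_on_compose2[OF cont\<xi>])
           (auto intro!: continuous_intros c\<gamma>[simplified] simp: norm_mult g')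
    qed
    have "continuous_on {0..1} (\<lambda>\<rho>. I \<rho> s)"
      using integral_continuous_on_param[OF c] by (simp add: I_def)
    then have "((\<lambda>\<rho>. I \<rho> s) \<longlongrightarrow> I 1 s) (at 1 within {0..1})"
      by (simp add: continuous_on)
    then show ?thesis
      by (simp add: at_within_Icc_at_left)
  qed
  have bnd: "cmod (J - I 1 s) \<le> 2 * pi * M' * (1 - s)" if s: "1/2 \<le> s" "s < 1" for s
  proof (rule tendsto_upperbound)
    show "((\<lambda>\<rho>. cmod (I \<rho> 1 - I \<rho> s)) \<longlongrightarrow> cmod (J - I 1 s)) (at_left 1)"
      by (intro tendsto_intros Jlim Ilim s)
    show "\<forall>\<^sub>F \<rho> in at_left 1. cmod (I \<rho> 1 - I \<rho> s) \<le> 2 * pi * M' * (1 - s)"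
      using eventually_at_left_real[of 0 1, simplified] by eventually_elim (use diff s in auto)
  qed simp
  have "((\<lambda>s. I 1 s - J) \<longlongrightarrow> 0) (at_left 1)"
  proof (rule Lim_null_comparison)
    show "\<forall>\<^sub>F s in at_left 1. norm (I 1 s - J) \<le> 2 * pi * M' * (1 - s)"
      using eventually_at_left_real[of "1/2" 1, simplified]
      by eventually_elim (use bnd norm_minus_commute in \<open>fastforce simp: norm_minus_commute\<close>)
    have "((\<lambda>s. 2 * pi * M' * (1 - s)) \<longlongrightarrow> 2 * pi * M' * (1 - 1)) (at_left (1::real))"
      by (intro tendsto_intros)
    then show "((\<lambda>s. 2 * pi * M' * (1 - s)) \<longlongrightarrow> 0) (at_left (1::real))" by simp
  qed
  then have "((\<lambda>s. I 1 s) \<longlongrightarrow> J) (at_left 1)" by (simp add: LIM_zero_iff)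
  then show ?thesis by (simp add: I_def J_def)
qed

section \<open>The Lie derivative of the metric\<close>

lemma hyp_metric_has_derivative:
  assumes "z \<in> disc"
  shows "((\<lambda>y. hyp_metric y u v) has_derivative (\<lambda>w. 16 * (u \<bullet> v) * (z \<bullet> w) / (1 - (cmod z)\<^sup>2) ^ 3)) (at z)"
proof -
  have nz: "1 - z \<bullet> z \<noteq> 0"
    using assms norm_ge_zero[of z] by (auto simp: dot_square_norm power2_eq_1_iff simp del: norm_ge_zero)
  have 1: "((\<lambda>y. 1 - y \<bullet> y) has_derivative (\<lambda>w. - 2 * (z \<bullet> w))) (at z)"
    by (auto intro!: derivative_eq_intros simp: inner_commute)
  have 2: "((\<lambda>x. 4 * (u \<bullet> v) / x\<^sup>2) has_field_derivative - 8 * (u \<bullet> v) / (1 - z \<bullet> z) ^ 3) (at (1 - z \<bullet> z))"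
    using nz by (auto intro!: derivative_eq_intros simp: divide_simps eval_nat_numeral)
  have "((\<lambda>y. 4 * (u \<bullet> v) / (1 - y \<bullet> y)\<^sup>2) has_derivative (\<lambda>w. 16 * (u \<bullet> v) * (z \<bullet> w) / (1 - z \<bullet> z) ^ 3)) (at z)"
    using DERIV_compose_FDERIV[OF 2 1] by (simp add: algebra_simps)
  then show ?thesis
    by (simp add: hyp_metric_def dot_square_norm)
qed

lemma lie_metric_eq:
  assumes z: "z \<in> disc" and D: "(\<xi> has_derivative D) (at z)"
  shows "lie_metric \<xi> z u v = 16 * (u \<bullet> v) * (z \<bullet> \<xi> z) / (1 - (cmod z)\<^sup>2) ^ 3
    + 4 * (D u \<bullet> v + u \<bullet> D v) / (1 - (cmod z)\<^sup>2)\<^sup>2"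
  unfolding lie_metric_def frechet_derivative_at[OF hyp_metric_has_derivative[OF z], symmetric]
    frechet_derivative_at[OF D, symmetric]
  by (simp add: hyp_metric_def add_divide_distrib distrib_left)

text \<open>Differentiating the conformal factor gives a multiple of the metric, which the
  trace-free part discards. What remains sees only the conjugate linear part of \<open>D\<close>; a
  map \<open>v \<mapsto> c * cnj v\<close> pairs with \<open>u\<close> to
  \<open>Re (cnj c * (u * v))\<close>, whence the conjugate.\<close>

lemma lie_metric_20_eq:
  assumes z: "z \<in> disc" and D: "(\<xi> has_derivative D) (at z)"
  shows "lie_metric_20 \<xi> z = of_real (4 / (1 - (cmod z)\<^sup>2)\<^sup>2) * cnj (D 1 + \<i> * D \<i>)"
proof -
  let ?l = "4 / (1 - (cmod z)\<^sup>2)\<^sup>2"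
  let ?h = "of_real ?l * cnj (D 1 + \<i> * D \<i>)"
  have l: "?l \<noteq> 0" using z norm_ge_zero[of z] by (auto simp: power2_eq_1_iff simp del: norm_ge_zero)
  have lin: "linear D" using D has_derivative_linear by blast
  define E where "E = 16 * (z \<bullet> \<xi> z) / (1 - (cmod z)\<^sup>2) ^ 3"
  have lm: "lie_metric \<xi> z u v = E * (u \<bullet> v) + ?l * (D u \<bullet> v + u \<bullet> D v)" for u v
    by (simp add: lie_metric_eq[OF z D] E_def)
  have met: "hyp_metric z u v = ?l * (u \<bullet> v)" for u v
    by (simp add: hyp_metric_def)
  have tr: "hyp_trace z (lie_metric \<xi> z) / 2 * hyp_metric z u v = (E + ?l * (D 1 \<bullet> 1 + \<i> \<bullet> D \<i>)) * (u \<bullet> v)" for u v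
    using l by (simp add: hyp_trace_def Basis_complex_def met lm inner_commute) (simp add: field_simps)
  have aux: "Re (of_real r * x * y) = r * Re (x * y)" for r x y by (simp add: algebra_simps)
  have tf: "lie_metric_trace_free \<xi> z u v = Re (?h * (u * v))" for u v
  proof -
    have "lie_metric_trace_free \<xi> z u v = ?l * ((D u \<bullet> v + u \<bullet> D v) - (D 1 \<bullet> 1 + \<i> \<bullet> D \<i>) * (u \<bullet> v))"
      unfolding lie_metric_trace_free_def tr lm by (simp add: algebra_simps)
    also have "(D u \<bullet> v + u \<bullet> D v) - (D 1 \<bullet> 1 + \<i> \<bullet> D \<i>) * (u \<bullet> v) = Re (cnj (D 1 + \<i> * D \<i>) * (u * v))"
      unfolding real_linear_complex_eq[OF lin, of u] real_linear_complex_eq[OF lin, of v]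
      by (simp add: inner_complex_def algebra_simps)
    finally show ?thesis by (simp only: aux)
  qed
  show ?thesis
    unfolding lie_metric_20_def
  proof (rule the_equality)
    show "\<forall>u v. lie_metric_trace_free \<xi> z u v = Re (?h * (u * v))" using tf by blast
    fix h assume "\<forall>u v. lie_metric_trace_free \<xi> z u v = Re (h * (u * v))"
    then have eq: "Re (h * (u * v)) = Re (?h * (u * v))" for u v using tf by metis
    have Re_ii: "Re (x * (1 * \<i>)) = - Im x" for x by simp
    \<comment> \<open>The pairs (1, 1) and (1, \<i>) test the real and the imaginary part.\<close>
    show "h = ?h"
      using eq[of 1 1] eq[of 1 "\<i>"] by (simp only: complex_eq_iff Re_ii mult_1_right neg_equal_iff_equal)
  qed
qed

text \<open>These polynomials are the infinitesimal Moebius motions of the disc. A holomorphic field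
  changes the metric by a conformal factor only; here the change of
  \<open>1 / (1 - |z|\<^sup>2)\<^sup>2\<close> along the field contributes
  \<open>16 * (z \<bullet> a)\<close> and the derivative of the field
  \<open>- 16 * (z \<bullet> a)\<close>, in the same units.\<close>

lemma quadratic_lie_metric:
  assumes z: "z \<in> disc" and b: "Re b = 0" and \<eta>: "\<And>w. w \<in> disc \<Longrightarrow> \<eta> w = a + b * w - cnj a * w\<^sup>2"
  shows "lie_metric \<eta> z u v = 0"
proof -
  have "((\<lambda>w. a + b * w - cnj a * w\<^sup>2) has_field_derivative b - 2 * cnj a * z) (at z)"
    by (auto intro!: derivative_eq_intros)
  then have "(\<eta> has_field_derivative b - 2 * cnj a * z) (at z)"
    by (rule has_field_derivative_transform_within_open[where S = disc]) (use z \<eta> in auto)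
  then have D: "(\<eta> has_derivative (\<lambda>v. (b - 2 * cnj a * z) * v)) (at z)"
    by (simp add: has_field_derivative_def)
  have nz: "1 - (cmod z)\<^sup>2 \<noteq> 0"
    using z norm_ge_zero[of z] by (auto simp: power2_eq_1_iff simp del: norm_ge_zero)
  have 1: "z \<bullet> \<eta> z = (1 - (cmod z)\<^sup>2) * (z \<bullet> a)"
    unfolding \<eta>[OF z] cmod_power2 using b by (simp add: inner_complex_def power2_eq_square algebra_simps)
  have 2: "((b - 2 * cnj a * z) * u) \<bullet> v + u \<bullet> ((b - 2 * cnj a * z) * v) = - 4 * (z \<bullet> a) * (u \<bullet> v)"
    using b by (simp add: inner_complex_def algebra_simps)
  have "q \<noteq> 0 \<Longrightarrow> 16 * x * (q * y) / q ^ 3 + 4 * (- 4 * y * x) / q\<^sup>2 = 0" for q x y :: real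
    by (simp add: field_simps eval_nat_numeral)
  from this[OF nz] show ?thesis
    unfolding lie_metric_eq[OF z D] 1 2 .
qed

lemma killing_fields_add_scaleR:
  assumes "m \<in> killing_fields" "m' \<in> killing_fields"
  shows "(\<lambda>z\<in>disc. m z + c *\<^sub>R m' z) \<in> killing_fields"
proof -
  let ?s = "\<lambda>z. m z + c *\<^sub>R m' z"
  have smooth: "smooth_on disc m" "smooth_on disc m'"
    and lie: "\<And>z u v. z \<in> disc \<Longrightarrow> lie_metric m z u v = 0" "\<And>z u v. z \<in> disc \<Longrightarrow> lie_metric m' z u v = 0"
    using assms by (auto simp: killing_fields_def)
  have "lie_metric (\<lambda>z\<in>disc. ?s z) z u v = 0" if z: "z \<in> disc" for z u v
  proof -
    let ?D = "frechet_derivative m (at z)" and ?D' = "frechet_derivative m' (at z)"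
    have D: "(m has_derivative ?D) (at z)" "(m' has_derivative ?D') (at z)"
      using smooth_on_open_imp_deriv(1)[OF open_ball _ z] smooth by auto
    have "(?s has_derivative (\<lambda>v. ?D v + c *\<^sub>R ?D' v)) (at z)"
      by (intro has_derivative_add has_derivative_scaleR_right D)
    then have Ds: "((\<lambda>z\<in>disc. ?s z) has_derivative (\<lambda>v. ?D v + c *\<^sub>R ?D' v)) (at z)"
      by (rule has_derivative_transform_within_open[OF _ open_ball z]) auto
    have "lie_metric (\<lambda>z\<in>disc. ?s z) z u v = lie_metric m z u v + c * lie_metric m' z u v"
      unfolding lie_metric_eq[OF z Ds] lie_metric_eq[OF z D(1)] lie_metric_eq[OF z D(2)]
      using z by (simp add: inner_add_left inner_add_right add_divide_distrib algebra_simps del: mem_ball)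
    then show ?thesis using lie[OF z] by simp
  qed
  moreover have "smooth_on disc (\<lambda>z\<in>disc. ?s z)"
    using smooth_on_add_scaleR[OF smooth] by (subst smooth_on_cong[where g = ?s]) auto
  ultimately show ?thesis
    by (auto simp: killing_fields_def)
qed

section \<open>Isometries are Moebius functions\<close>

text \<open>\<open>D 1\<close> and \<open>D \<i>\<close> are orthogonal of equal length, so
  \<open>D \<i>\<close> is \<i> or -\<i> times \<open>D 1\<close>; the orientation selects the
  sign.\<close>

lemma conformal_imp_complex_linear:
  assumes lin: "linear D" and l: "l > 0"
    and iso: "\<And>u v. D u \<bullet> D v = l * (u \<bullet> v)" and pos: "Im (cnj (D 1) * D \<i>) > 0"
  shows "D v = D 1 * v" "(cmod (D 1))\<^sup>2 = l"
proof -
  let ?p = "D 1" and ?q = "D \<i>"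
  have p: "?p \<bullet> ?p = l" and q: "?q \<bullet> ?q = l" and pq: "?p \<bullet> ?q = 0"
    using iso[of 1 1] iso[of "\<i>" "\<i>"] iso[of 1 "\<i>"] by (auto simp: inner_complex_def)
  show p2: "(cmod ?p)\<^sup>2 = l" using p by (simp add: dot_square_norm)
  have "(cmod (cnj ?p * ?q))\<^sup>2 = l\<^sup>2"
    using p q by (simp add: norm_mult power_mult_distrib dot_square_norm power2_eq_square[of l])
  moreover have re: "Re (cnj ?p * ?q) = 0" using pq by (simp add: inner_complex_def)
  ultimately have "(Im (cnj ?p * ?q))\<^sup>2 = l\<^sup>2" by (simp only: cmod_power2) simp
  then have "Im (cnj ?p * ?q) = l"
    using pos l by (simp only: power2_eq_iff_nonneg less_imp_le)
  then have "cnj ?p * ?q = \<i> * of_real l" using re by (simp only: complex_eq_iff) simp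
  also have "of_real l = ?p * cnj ?p" using complex_norm_square[of ?p] p2 by simp
  finally have "cnj ?p * (?q - \<i> * ?p) = 0" by (simp add: algebra_simps)
  moreover have "?p \<noteq> 0" using p l by auto
  ultimately have q: "?q = \<i> * ?p" by simp
  show "D v = D 1 * v"
    by (subst real_linear_complex_eq[OF lin]) (simp add: q complex_eq_iff)
qed

text \<open>The condition on the product, rather than on \<open>z\<close> alone, reaches the unit
  circle and a neighbourhood of it.\<close>

lemma Moebius_denominator_nonzero:
  assumes "cmod a * cmod z < 1"
  shows "1 - cnj a * z \<noteq> 0"
proof
  assume "1 - cnj a * z = 0"
  then have "cnj a * z = 1" by simp
  then have "cmod a * cmod z = 1" by (metis complex_mod_cnj norm_mult norm_one)
  then show False using assms by simp
qed

lemma Moebius_function_has_derivative: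
  assumes "cmod a * cmod z < 1"
  shows "(Moebius_function t a has_field_derivative exp (\<i> * of_real t) * (1 - (cmod a)\<^sup>2) / (1 - cnj a * z)\<^sup>2) (at z)"
proof -
  let ?e = "exp (\<i> * of_real t)"
  have "(Moebius_function t a has_field_derivative
      (?e * (1 - cnj a * z) - ?e * (z - a) * (- cnj a)) / ((1 - cnj a * z) * (1 - cnj a * z))) (at z)"
    unfolding Moebius_function_def
    using Moebius_denominator_nonzero[OF assms] by (auto intro!: derivative_eq_intros)
  also have "?e * (1 - cnj a * z) - ?e * (z - a) * (- cnj a) = ?e * (1 - a * cnj a)"
    by (simp add: algebra_simps)
  finally show ?thesis
    by (simp only: power2_eq_square[of "1 - cnj a * z"] complex_norm_square of_real_diff of_real_1)
qed

text \<open>Rests on \<open>|1 - cnj a * z|\<^sup>2 - |z - a|\<^sup>2 = (1 - |a|\<^sup>2) * (1 -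
  |z|\<^sup>2)\<close>. It gives the transformation of the weight in the d-bar derivative under
  pullback.\<close>

lemma Moebius_function_isometry:
  assumes "cmod a < 1" "cmod z < 1"
  shows "1 - (cmod (Moebius_function t a z))\<^sup>2 = cmod (deriv (Moebius_function t a) z) * (1 - (cmod z)\<^sup>2)"
proof -
  have az: "cmod a * cmod z < 1"
    using mult_left_mono[of "cmod z" 1 "cmod a"] assms by simp
  let ?w = "1 - cnj a * z"
  have w: "?w \<noteq> 0" by (rule Moebius_denominator_nonzero[OF az])
  have a1: "(cmod a)\<^sup>2 < 1" using assms by (simp add: power_less_one_iff)
  have n: "cmod (1 - (complex_of_real (cmod a))\<^sup>2) = \<bar>1 - (cmod a)\<^sup>2\<bar>"
    by (metis norm_of_real of_real_1 of_real_diff of_real_power)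
  have "cmod (deriv (Moebius_function t a) z) = \<bar>1 - (cmod a)\<^sup>2\<bar> / (cmod ?w)\<^sup>2"
    unfolding DERIV_imp_deriv[OF Moebius_function_has_derivative[OF az]]
    by (simp add: norm_mult norm_divide norm_power n)
  then have d: "cmod (deriv (Moebius_function t a) z) = (1 - (cmod a)\<^sup>2) / (cmod ?w)\<^sup>2"
    using a1 by simp
  have m: "(cmod (Moebius_function t a z))\<^sup>2 = (cmod (z - a))\<^sup>2 / (cmod ?w)\<^sup>2"
    by (simp add: Moebius_function_def norm_mult norm_divide power_divide)
  have "(cmod ?w)\<^sup>2 - (cmod (z - a))\<^sup>2 = (1 - (cmod a)\<^sup>2) * (1 - (cmod z)\<^sup>2)"
    unfolding cmod_power2 by (simp add: power2_eq_square algebra_simps)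
  then show ?thesis
    unfolding d m using w by (simp add: field_simps)
qed

lemma isom_plus_holomorphic:
  assumes "\<gamma> \<in> carrier isom_plus"
  shows "\<gamma> holomorphic_on disc" "\<gamma> ` disc = disc"
    "\<And>z. z \<in> disc \<Longrightarrow> 1 - (cmod (\<gamma> z))\<^sup>2 = cmod (deriv \<gamma> z) * (1 - (cmod z)\<^sup>2)"
proof -
  have Bij: "\<gamma> \<in> Bij disc" and smooth: "smooth_on disc \<gamma>"
    and iso: "\<And>z u v. z \<in> disc \<Longrightarrow> hyp_metric (\<gamma> z)
        (frechet_derivative \<gamma> (at z) u) (frechet_derivative \<gamma> (at z) v) = hyp_metric z u v"
    and pos: "\<And>z. z \<in> disc \<Longrightarrow> Im (cnj (frechet_derivative \<gamma> (at z) 1) * frechet_derivative \<gamma> (at z) \<i>) > 0"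
    using assms by (auto simp: isom_plus_def)
  show im: "\<gamma> ` disc = disc" using Bij by (auto simp: Bij_def bij_betw_def)
  have *: "(\<gamma> has_field_derivative frechet_derivative \<gamma> (at z) 1) (at z) \<and>
       1 - (cmod (\<gamma> z))\<^sup>2 = cmod (frechet_derivative \<gamma> (at z) 1) * (1 - (cmod z)\<^sup>2)" if z: "z \<in> disc" for z
  proof -
    let ?D = "frechet_derivative \<gamma> (at z)"
    have der: "(\<gamma> has_derivative ?D) (at z)"
      by (rule smooth_on_open_imp_deriv(1)[OF _ smooth z]) simp
    have gz: "\<gamma> z \<in> disc" using im z by blast
    have n: "(cmod z)\<^sup>2 < 1" "(cmod (\<gamma> z))\<^sup>2 < 1" using z gz by (auto simp: power_less_one_iff)
    \<comment> \<open>Preservation of the metric is conformality with factor \<open>l\<close>, the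
      quotient of the two conformal densities.\<close>
    define l where "l = ((1 - (cmod (\<gamma> z))\<^sup>2) / (1 - (cmod z)\<^sup>2))\<^sup>2"
    have l: "l > 0" using n by (simp add: l_def)
    have iso': "?D u \<bullet> ?D v = l * (u \<bullet> v)" for u v
      using iso[OF z, of u v] n by (simp add: hyp_metric_def l_def power_divide field_simps)
    note c = conformal_imp_complex_linear[OF has_derivative_linear[OF der] l iso' pos[OF z]]
    have "cmod (?D 1) = (1 - (cmod (\<gamma> z))\<^sup>2) / (1 - (cmod z)\<^sup>2)"
      using c(2) n unfolding l_def by (subst (asm) power2_eq_iff_nonneg) auto
    then have "1 - (cmod (\<gamma> z))\<^sup>2 = cmod (?D 1) * (1 - (cmod z)\<^sup>2)"
      using n by (simp add: field_simps)
    moreover have "(\<gamma> has_field_derivative ?D 1) (at z)"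
      using der c(1) unfolding has_field_derivative_def by (metis (no_types, lifting) ext)
    ultimately show ?thesis by simp
  qed
  then show "\<gamma> holomorphic_on disc"
    unfolding holomorphic_on_open[OF open_ball] by blast
  show "1 - (cmod (\<gamma> z))\<^sup>2 = cmod (deriv \<gamma> z) * (1 - (cmod z)\<^sup>2)" if "z \<in> disc" for z
    using *[OF that] DERIV_imp_deriv by metis
qed

text \<open>Normalised to fix 0, an isometry attains equality in the Schwarz lemma.\<close>

lemma isom_plus_Moebius:
  assumes "\<gamma> \<in> carrier isom_plus"
  obtains t a where "cmod a < 1" "\<And>z. z \<in> disc \<Longrightarrow> \<gamma> z = Moebius_function t a z"
proof -
  note iso = isom_plus_holomorphic[OF assms]
  define b where "b = \<gamma> 0"
  have b: "cmod b < 1" using iso(2) by (force simp: b_def)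
  have b1: "(cmod b)\<^sup>2 < 1" using b by (simp add: power_less_one_iff)
  have in_disc: "cmod (\<gamma> z) < 1" if "cmod z < 1" for z using iso(2) that by force
  define h where "h = Moebius_function 0 b \<circ> \<gamma>"
  have hol: "h holomorphic_on disc"
    unfolding h_def by (rule holomorphic_on_compose_gen[OF iso(1) Moebius_function_holomorphic[OF b]]) (use iso(2) in auto)
  have h0: "h 0 = 0" by (simp add: h_def b_def Moebius_function_eq_zero)
  have hb: "cmod (h z) < 1" if "cmod z < 1" for z
    unfolding h_def o_def by (rule Moebius_function_norm_lt_1[OF b in_disc[OF that]])
  have bb: "cmod b * cmod b < 1" using b1 by (simp add: power2_eq_square)
  \<comment> \<open>The Moebius function centred at \<open>b\<close> has derivative of modulus
    \<open>1 / (1 - |b|\<^sup>2)\<close> at \<open>b\<close>, the reciprocal of the modulus of the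
    derivative of \<open>\<gamma>\<close> at 0.\<close>
  have "cmod (deriv h 0) = 1"
  proof -
    have d: "(\<gamma> has_field_derivative deriv \<gamma> 0) (at 0)"
      by (rule holomorphic_derivI[OF iso(1)]) auto
    have "(Moebius_function 0 b has_field_derivative (1 - (cmod b)\<^sup>2) / (1 - cnj b * b)\<^sup>2) (at (\<gamma> 0))"
      using Moebius_function_has_derivative[OF bb, of 0] by (simp add: b_def)
    from DERIV_chain[OF this d] have "deriv h 0 = (1 - (cmod b)\<^sup>2) / (1 - cnj b * b)\<^sup>2 * deriv \<gamma> 0"
      unfolding h_def by (rule DERIV_imp_deriv)
    moreover have "cnj b * b = of_real ((cmod b)\<^sup>2)" using complex_norm_square[of b] by (simp add: mult.commute)
    ultimately have "deriv h 0 = of_real ((1 - (cmod b)\<^sup>2) / (1 - (cmod b)\<^sup>2)\<^sup>2) * deriv \<gamma> 0"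
      by simp
    then have "cmod (deriv h 0) = (1 - (cmod b)\<^sup>2) / (1 - (cmod b)\<^sup>2)\<^sup>2 * cmod (deriv \<gamma> 0)"
      using b1 by (simp only: norm_mult norm_of_real) simp
    moreover have "cmod (deriv \<gamma> 0) = 1 - (cmod b)\<^sup>2" using iso(3)[of 0] by (simp add: b_def)
    ultimately show ?thesis using b1 by (simp add: power2_eq_square)
  qed
  then obtain c where c: "\<And>z. cmod z < 1 \<Longrightarrow> h z = c * z" "cmod c = 1"
    using Schwarz_Lemma(3)[OF hol h0 hb, of 0] by auto
  \<comment> \<open>The zero of \<open>c * z + b\<close>, since \<open>c\<close> has modulus
    1.\<close>
  define a where "a = - b * cnj c"
  have cc: "c * cnj c = 1" using c(2) by (simp add: complex_norm_square[symmetric])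
  have a: "cmod a < 1" using b c(2) by (simp add: a_def norm_mult)
  have "\<gamma> z = Moebius_function (Arg c) a z" if "z \<in> disc" for z
  proof -
    have z: "cmod z < 1" using that by simp
    have "\<gamma> z = Moebius_function 0 (- b) (h z)"
      unfolding h_def o_def by (rule Moebius_function_compose[symmetric]) (use b in_disc z in auto)
    also have "\<dots> = (c * z + b) / (1 + cnj b * (c * z))"
      by (simp add: Moebius_function_def c(1)[OF z])
    also have "\<dots> = c * (z - a) / (1 - cnj a * z)"
    proof -
      have "c * (z - a) = c * z + b" using cc by (simp add: a_def algebra_simps)
      moreover have "1 - cnj a * z = 1 + cnj b * (c * z)" by (simp add: a_def)
      ultimately show ?thesis by simp
    qed
    also have "c = exp (\<i> * of_real (Arg c))"
      using Arg_eq[of c] c(2) by force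
    finally show ?thesis by (simp add: Moebius_function_def)
  qed
  with a that show ?thesis by blast
qed

text \<open>With \<open>w = 1 - cnj a * cis t\<close>, which has positive real part, the Moebius function takes the value
  \<open>cis \<theta> * cis t * cnj w / w\<close> at \<open>cis t\<close>.\<close>

definition circle_lift :: "real \<Rightarrow> complex \<Rightarrow> real \<Rightarrow> real" where
  "circle_lift \<theta> a t = \<theta> + t - 2 * Im (Ln (1 - cnj a * cis t))"

text \<open>The modulus of the derivative of the Moebius function on the circle: a Poisson
  kernel.\<close>

definition circle_lift_deriv :: "complex \<Rightarrow> real \<Rightarrow> real" where
  "circle_lift_deriv a t = (1 - (cmod a)\<^sup>2) / (cmod (1 - cnj a * cis t))\<^sup>2"

text \<open>The second equation is what differentiating the first in \<open>t\<close> predicts: the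
  derivative at \<open>cis t\<close> is a positive multiple of the quotient of image and argument,
  which keeps pullbacks tangential. The last three facts are the hypotheses of the substitution
  lemmas, the 4 coming from \<open>|1 - cnj a * cis t| \<le> 2\<close>.\<close>

lemma circle_lift:
  assumes a: "cmod a < 1"
  shows "Moebius_function \<theta> a (cis t) = cis (circle_lift \<theta> a t)"
    and "deriv (Moebius_function \<theta> a) (cis t) = of_real (circle_lift_deriv a t) * cis (circle_lift \<theta> a t - t)"
    and "(circle_lift \<theta> a has_real_derivative circle_lift_deriv a t) (at t)"
    and "continuous_on UNIV (circle_lift_deriv a)"
    and "(1 - (cmod a)\<^sup>2) / 4 \<le> circle_lift_deriv a t"
proof -
  have az: "cmod a * cmod (cis t) < 1" for t using a by simp
  let ?w = "\<lambda>t. 1 - cnj a * cis t"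
  have w0: "?w t \<noteq> 0" for t by (rule Moebius_denominator_nonzero[OF az])
  have a1: "(cmod a)\<^sup>2 < 1" using a by (simp add: power_less_one_iff)
  \<comment> \<open>This keeps the argument of \<open>Ln\<close> off the branch cut, so the lift is
    differentiable everywhere.\<close>
  have wRe: "Re (?w t) > 0" for t
  proof -
    have "Re (cnj a * cis t) \<le> cmod (cnj a * cis t)" by (rule complex_Re_le_cmod)
    also have "\<dots> < 1" using a by (simp add: norm_mult)
    finally show ?thesis by simp
  qed
  have lift: "cis (circle_lift \<theta> a t) = exp (\<i> * of_real \<theta>) * cis t * (cnj (?w t) / ?w t)" for t
  proof -
    have "cis (- 2 * Im (Ln (?w t))) = exp (cnj (Ln (?w t)) - Ln (?w t))"
      by (simp add: cis_conv_exp) (rule arg_cong[of _ _ exp], simp add: complex_eq_iff)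
    also have "\<dots> = cnj (?w t) / ?w t"
      by (simp only: exp_diff exp_cnj[symmetric] exp_Ln[OF w0])
    finally have 1: "cis (- 2 * Im (Ln (?w t))) = cnj (?w t) / ?w t" .
    have "cis (circle_lift \<theta> a t) = cis \<theta> * cis t * cis (- 2 * Im (Ln (?w t)))"
      by (simp add: circle_lift_def cis_mult)
    then show ?thesis by (simp only: 1 cis_conv_exp[of \<theta>])
  qed
  have cc: "cis t * cnj (?w t) = cis t - a" for t
    by (simp add: algebra_simps cis_cnj) (simp add: mult.left_commute cis_mult)
  show "Moebius_function \<theta> a (cis t) = cis (circle_lift \<theta> a t)"
    unfolding lift Moebius_function_def using cc[of t] by (simp add: mult.assoc)
  show "deriv (Moebius_function \<theta> a) (cis t) = of_real (circle_lift_deriv a t) * cis (circle_lift \<theta> a t - t)"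
  proof -
    have "of_real (circle_lift_deriv a t) * cis (circle_lift \<theta> a t - t) =
       of_real (1 - (cmod a)\<^sup>2) / (?w t * cnj (?w t)) * (cis (circle_lift \<theta> a t) / cis t)"
      by (simp only: circle_lift_deriv_def of_real_divide complex_norm_square cis_divide)
    also have "\<dots> = exp (\<i> * of_real \<theta>) * (1 - (cmod a)\<^sup>2) / (?w t)\<^sup>2"
    proof -
      have "W \<noteq> 0 \<Longrightarrow> c \<noteq> 0 \<Longrightarrow> V \<noteq> 0 \<Longrightarrow> A / (W * V) * (e * c * (V / W) / c) = e * A / W\<^sup>2"
        for A W V e c :: complex
        by (simp add: field_simps power2_eq_square)
      from this[of "?w t" "cis t" "cnj (?w t)"] show ?thesis
        unfolding lift using w0[of t] by (simp only: complex_cnj_zero_iff cis_neq_zero not_False_eq_True of_real_diff of_real_1)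
    qed
    finally show ?thesis
      unfolding DERIV_imp_deriv[OF Moebius_function_has_derivative[OF az]] by simp
  qed
  show "(circle_lift \<theta> a has_real_derivative circle_lift_deriv a t) (at t)"
  proof -
    have "(?w has_vector_derivative - (cnj a * (\<i> * cis t))) (at t)"
      using has_vector_derivative_diff[OF has_vector_derivative_const has_vector_derivative_mult_right[OF has_vector_derivative_cis]]
      by simp
    moreover have "(Ln has_field_derivative inverse (?w t)) (at (?w t))"
      by (rule has_field_derivative_Ln) (use wRe[of t] complex_nonpos_Reals_iff in force)
    ultimately have "((\<lambda>t. Ln (?w t)) has_vector_derivative - (cnj a * (\<i> * cis t)) * inverse (?w t)) (at t)"
      using field_vector_diff_chain_at by (fastforce simp: o_def)
    from bounded_linear.has_vector_derivative[OF bounded_linear_Im this]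
    have der_Im: "((\<lambda>t. Im (Ln (?w t))) has_real_derivative Im (- (cnj a * (\<i> * cis t)) * inverse (?w t))) (at t)"
      by (simp add: has_real_derivative_iff_has_vector_derivative)
    have "(circle_lift \<theta> a has_real_derivative 1 - 2 * Im (- (cnj a * (\<i> * cis t)) * inverse (?w t))) (at t)"
      using DERIV_diff[OF DERIV_add[OF DERIV_const DERIV_ident] DERIV_cmult[OF der_Im, of 2]]
      unfolding circle_lift_def by (simp only: add_0)
    also have "1 - 2 * Im (- (cnj a * (\<i> * cis t)) * inverse (?w t)) = circle_lift_deriv a t"
    proof -
      \<comment> \<open>In terms of \<open>u\<close>, which has modulus \<open>|a|\<close>, the
        claim is \<open>1 + 2 * Re (u / (1 - u)) = (1 - |u|\<^sup>2) / |1 -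
        u|\<^sup>2\<close>.\<close>
      define u where "u = cnj a * cis t"
      have u: "(cmod a)\<^sup>2 = (cmod u)\<^sup>2" by (simp add: u_def norm_mult)
      have nz: "1 - u \<noteq> 0" using w0[of t] by (simp add: u_def)
      have n: "(cmod (1 - u))\<^sup>2 = 1 - 2 * Re u + (cmod u)\<^sup>2"
        unfolding cmod_power2 by (simp add: power2_eq_square algebra_simps)
      have "- (cnj a * (\<i> * cis t)) * inverse (?w t) = - \<i> * (u / (1 - u))"
        unfolding u_def divide_inverse by (simp add: mult_ac)
      moreover have "Im (- \<i> * x) = - Re x" for x by simp
      ultimately have "Im (- (cnj a * (\<i> * cis t)) * inverse (?w t)) = - Re (u / (1 - u))"
        by (simp only:)
      also have "u / (1 - u) = u * cnj (1 - u) / of_real ((cmod (1 - u))\<^sup>2)"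
        unfolding complex_norm_square using nz by (simp del: complex_cnj_diff)
      also have "Re \<dots> = (Re u - (cmod u)\<^sup>2) / (cmod (1 - u))\<^sup>2"
        by (simp only: Re_divide_of_real cmod_power2[of u]) (simp add: power2_eq_square algebra_simps)
      finally have "1 - 2 * Im (- (cnj a * (\<i> * cis t)) * inverse (?w t)) = 1 + 2 * ((Re u - (cmod u)\<^sup>2) / (cmod (1 - u))\<^sup>2)"
        by simp
      also have "\<dots> = (1 - (cmod u)\<^sup>2) / (cmod (1 - u))\<^sup>2"
        using nz n by (simp add: field_simps)
      finally show ?thesis by (simp add: circle_lift_deriv_def u_def[symmetric] u)
    qed
    finally show ?thesis .
  qed
  show "continuous_on UNIV (circle_lift_deriv a)"
    unfolding circle_lift_deriv_def using w0 by (intro continuous_intros) auto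
  have "cmod (?w t) \<le> 2"
    using norm_triangle_ineq4[of 1 "cnj a * cis t"] a by (simp add: norm_mult)
  then have "(cmod (?w t))\<^sup>2 \<le> 2\<^sup>2" by (intro power_mono) auto
  then show "(1 - (cmod a)\<^sup>2) / 4 \<le> circle_lift_deriv a t"
    unfolding circle_lift_deriv_def using a1 w0[of t] by (intro divide_left_mono) auto
qed

section \<open>Pullbacks by isometries and Fourier coefficients\<close>

text \<open>An almost-everywhere relation survives composition with \<open>\<alpha>\<close> because
  preimages of null sets are null. This is extracted from the substitution bound by applying it to
  \<open>\<phi>\<close>, the defect of the relation, whose integral vanishes.\<close>

lemma AE_circle_reparam:
  assumes tang: "tangential Y" and Y: "Y \<in> borel_measurable circle_measure"
    and \<alpha>: "\<And>t. (\<alpha> has_real_derivative \<alpha>' t) (at t)"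
      "continuous_on UNIV \<alpha>'" "0 < m" "\<And>t. m \<le> \<alpha>' t"
  shows "AE t in lborel. t \<in> {0..2*pi} \<longrightarrow> Y (cis (\<alpha> t)) = - cis (2 * \<alpha> t) * cnj (Y (cis (\<alpha> t)))"
proof -
  obtain C where C: "\<And>\<phi> :: complex \<Rightarrow> real. (\<lambda>t. \<phi> (cis t)) \<in> borel_measurable borel \<Longrightarrow> (\<And>z. 0 \<le> \<phi> z) \<Longrightarrow>
      (\<integral>\<^sup>+t\<in>{0..2*pi}. ennreal (\<phi> (cis (\<alpha> t))) \<partial>lborel) \<le> ennreal C * (\<integral>\<^sup>+t\<in>{0..2*pi}. ennreal (\<phi> (cis t)) \<partial>lborel)"
    using nn_integral_circle_reparam[OF \<alpha>] by (elim exE conjE) auto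
  define \<phi> where "\<phi> = (\<lambda>z. cmod (Y z + z\<^sup>2 * cnj (Y z)))"
  have id: "(\<lambda>z. z) \<in> borel_measurable circle_measure"
    by (rule measurable_circle_continuous) (rule continuous_on_id)
  have \<phi>: "\<phi> \<in> borel_measurable circle_measure"
  proof -
    have "(\<lambda>z. cnj (Y z)) \<in> borel_measurable circle_measure"
      by (rule measurable_compose[OF Y]) (intro borel_measurable_continuous_onI continuous_intros)
    then have "(\<lambda>z. Y z + z\<^sup>2 * cnj (Y z)) \<in> borel_measurable circle_measure"
      by (intro borel_measurable_add borel_measurable_times borel_measurable_power Y id)
    then show ?thesis unfolding \<phi>_def by (rule measurable_compose[OF _ borel_measurable_norm])
  qed
  have \<phi>c: "(\<lambda>t. \<phi> (cis t)) \<in> borel_measurable borel" by (rule measurable_on_circle[OF \<phi>])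
  have space: "space circle_measure = sphere 0 1"
    by (simp add: circle_measure_def space_restrict_space)
  have "AE z in circle_measure. ennreal (\<phi> z) = 0"
  proof -
    obtain f :: "complex \<Rightarrow> real" where f: "AE z in circle_measure. Y z = of_real (f z) * (\<i> * z)"
      using tang by (auto simp: tangential_def)
    show ?thesis
      using f AE_space
    proof eventually_elim
      case (elim z)
      have "z * cnj z = 1" using elim(2) space complex_norm_square[of z] by simp
      then have "z\<^sup>2 * cnj (Y z) = - Y z"
        unfolding elim(1) by (simp add: power2_eq_square algebra_simps)
      then show ?case by (simp add: \<phi>_def)
    qed
  qed
  then have "(\<integral>\<^sup>+z. ennreal (\<phi> z) \<partial>circle_measure) = 0"
    by (intro nn_integral_0_iff_AE[THEN iffD2]) (use \<phi> in simp_all)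
  then have "(\<integral>\<^sup>+t\<in>{0..2*pi}. ennreal (\<phi> (cis t)) \<partial>lborel) = 0"
    by (subst (asm) nn_integral_circle_measure) (use \<phi> in auto)
  then have "(\<integral>\<^sup>+t\<in>{0..2*pi}. ennreal (\<phi> (cis (\<alpha> t))) \<partial>lborel) = 0"
    using C[of \<phi>, OF \<phi>c] by (simp add: \<phi>_def)
  moreover have "(\<lambda>t. \<phi> (cis (\<alpha> t))) \<in> borel_measurable borel"
  proof -
    have "\<alpha> \<in> borel_measurable borel"
      by (intro borel_measurable_continuous_onI continuous_at_imp_continuous_on) (use \<alpha>(1) DERIV_isCont in blast)
    from measurable_compose[OF this \<phi>c] show ?thesis .
  qed
  ultimately have "AE t in lborel. ennreal (\<phi> (cis (\<alpha> t))) * indicator {0..2*pi} t = 0"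
    by (subst (asm) nn_integral_0_iff_AE) auto
  then show ?thesis
  proof eventually_elim
    case (elim t)
    show ?case
    proof
      assume "t \<in> {0..2*pi}"
      then have "ennreal (\<phi> (cis (\<alpha> t))) = 0" using elim by simp
      then have "Y (cis (\<alpha> t)) + (cis (\<alpha> t))\<^sup>2 * cnj (Y (cis (\<alpha> t))) = 0"
        by (simp add: \<phi>_def)
      then show "Y (cis (\<alpha> t)) = - cis (2 * \<alpha> t) * cnj (Y (cis (\<alpha> t)))"
        by (simp add: Complex.DeMoivre add_eq_0_iff2)
    qed
  qed
qed

text \<open>The symmetry of \<open>A\<close> expresses that the pullback of \<open>Y\<close> is tangential: \<open>Z / (\<i> z)\<close> is real exactly when
  \<open>Z = - z\<^sup>2 cnj Z\<close>.\<close>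

lemma pullback_fourier_coeffs:
  fixes \<xi> Y :: "complex \<Rightarrow> complex" and D :: "complex \<Rightarrow> complex \<Rightarrow> complex" and \<theta> :: real
  assumes der: "\<And>z. z \<in> disc \<Longrightarrow> (\<xi> has_derivative D z) (at z)"
    and contD: "\<And>v. continuous_on disc (\<lambda>z. D z v)"
    and M: "\<And>z. z \<in> disc \<Longrightarrow> cmod (D z 1 + \<i> * D z \<i>) \<le> M"
    and XY: "has_L2_extension \<xi> Y" and tang: "tangential Y"
    and a: "cmod a < 1"
  defines "g \<equiv> Moebius_function \<theta> a"
  shows "\<exists>A. (\<forall>n. (circle_coeff (\<lambda>z. \<xi> (g z) * inverse (deriv g z)) n \<longlongrightarrow> A n) (at_left 1)) \<and>
    (\<forall>n. A n = - cnj (A (2 - n)))"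
proof -
  note lift = circle_lift(1-3)[OF a, where \<theta> = \<theta>] circle_lift(4,5)[OF a]
  let ?\<alpha> = "circle_lift \<theta> a"
  have m: "0 < (1 - (cmod a)\<^sup>2) / 4" using a by (simp add: power_less_one_iff)
  have pos: "circle_lift_deriv a t > 0" for t using lift(5)[of t] m by linarith
  define F where "F = (\<lambda>n::int. \<lambda>t. Y (cis (?\<alpha> t)) * (inverse (deriv g (cis t)) * cis (- of_int n * t)))"
  define A where "A = (\<lambda>n. LBINT t:{0..2*pi}. F n t)"
  let ?V = "{z. cmod a * cmod z < 1}"
  \<comment> \<open>On \<open>?V\<close>, which contains the closed disc, the Moebius function is
    holomorphic; the origin is removed because of the powers of z in \<open>k\<close>.\<close>
  define U where "U = ?V - {0}"
  have "open ?V" by (intro open_Collect_less continuous_intros)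
  then have U: "open U" "{z. 1/2 \<le> cmod z \<and> cmod z \<le> 1} \<subseteq> U"
    using a by (auto simp: U_def intro: le_less_trans[OF mult_left_le])
  have gder: "(g has_field_derivative exp (\<i> * of_real \<theta>) * (1 - (cmod a)\<^sup>2) / (1 - cnj a * z)\<^sup>2) (at z)" if "z \<in> ?V" for z
    unfolding g_def by (rule Moebius_function_has_derivative) (use that in auto)
  have ghol: "g holomorphic_on ?V"
    using gder \<open>open ?V\<close> by (metis holomorphic_on_open)
  have a2: "1 - (complex_of_real (cmod a))\<^sup>2 \<noteq> 0"
    using m by (metis diff_gt_0_iff_gt diff_numeral_special(9) eq_iff_diff_eq_0 less_irrefl of_real_1 of_real_eq_iff of_real_power zero_less_divide_iff zero_less_numeral)
  have g'0: "deriv g z \<noteq> 0" if "z \<in> ?V" for z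
    unfolding DERIV_imp_deriv[OF gder[OF that]]
    using a2 Moebius_denominator_nonzero that by auto
  have g'hol: "(\<lambda>z. inverse (deriv g z)) holomorphic_on ?V"
    by (intro holomorphic_intros holomorphic_deriv ghol \<open>open ?V\<close>) (use g'0 in auto)
  have lim: "((\<lambda>s. integral {0..2*pi} (\<lambda>t. \<xi> (g (of_real s * cis t)) * inverse (deriv g (of_real s * cis t)) * cis (- of_int n * t)))
        \<longlongrightarrow> A n) (at_left 1)" for n
  proof -
    \<comment> \<open>The integrals in the boundary lemma carry a further factor z, hence the
      exponent \<open>- n - 1\<close> instead of \<open>- n\<close>.\<close>
    define k where "k = (\<lambda>z. inverse (deriv g z) * z powi (- n - 1))"
    have khol: "k holomorphic_on U"
      unfolding k_def by (intro holomorphic_intros holomorphic_on_subset[OF g'hol]) (auto simp: U_def)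
    have kz: "k z * z = inverse (deriv g z) * z powi (- n)" if "z \<noteq> 0" for z
      using that power_int_add[of z "- n - 1" 1] by (simp add: k_def mult.assoc)
    have "((\<lambda>s. integral {0..2*pi} (\<lambda>t. \<xi> (g (of_real s * cis t)) * k (of_real s * cis t) * (of_real s * cis t))) \<longlongrightarrow>
      (LBINT t:{0..2*pi}. Y (cis (?\<alpha> t)) * (k (cis t) * cis t))) (at_left 1)"
      by (rule tendsto_dbar_bounded_boundary[OF der contD M XY U holomorphic_on_subset[OF ghol] khol _ _ lift(3,4) m lift(5)])
         (use Moebius_function_norm_lt_1[OF a] lift(1) in \<open>auto simp: U_def g_def\<close>)
    also have "(LBINT t:{0..2*pi}. Y (cis (?\<alpha> t)) * (k (cis t) * cis t)) = A n"
      by (simp add: A_def F_def kz cis_power_int)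
    finally have 1: "((\<lambda>s. integral {0..2*pi} (\<lambda>t. \<xi> (g (of_real s * cis t)) * k (of_real s * cis t) * (of_real s * cis t))) \<longlongrightarrow> A n) (at_left 1)" .
    \<comment> \<open>At radius \<open>s\<close> the power of z brings in
      \<open>s powi (- n)\<close>, which \<open>circle_coeff\<close> does not have. The compensating
      factor tends to 1.\<close>
    have "((\<lambda>s. of_real s powi n * integral {0..2*pi} (\<lambda>t. \<xi> (g (of_real s * cis t)) * k (of_real s * cis t) * (of_real s * cis t)))
       \<longlongrightarrow> of_real 1 powi n * A n) (at_left 1)"
      by (intro tendsto_mult 1 tendsto_power_int tendsto_of_real tendsto_ident_at) auto
    then have "((\<lambda>s. of_real s powi n * integral {0..2*pi} (\<lambda>t. \<xi> (g (of_real s * cis t)) * k (of_real s * cis t) * (of_real s * cis t)))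
       \<longlongrightarrow> A n) (at_left 1)" by simp
    then show ?thesis
    proof (rule Lim_transform_eventually)
      show "\<forall>\<^sub>F s in at_left 1. of_real s powi n * integral {0..2*pi} (\<lambda>t. \<xi> (g (of_real s * cis t)) * k (of_real s * cis t) * (of_real s * cis t))
        = integral {0..2*pi} (\<lambda>t. \<xi> (g (of_real s * cis t)) * inverse (deriv g (of_real s * cis t)) * cis (- of_int n * t))"
        using eventually_at_left_real[of 0 1, simplified]
      proof eventually_elim
        case (elim s)
        then have s: "s \<noteq> 0" by simp
        have "of_real s powi n * (\<xi> (g (of_real s * cis t)) * k (of_real s * cis t) * (of_real s * cis t))
           = \<xi> (g (of_real s * cis t)) * inverse (deriv g (of_real s * cis t)) * cis (- of_int n * t)" for t
        proof -
          have "k (of_real s * cis t) * (of_real s * cis t) = inverse (deriv g (of_real s * cis t)) * (of_real s powi (- n) * cis (- of_int n * t))"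
            using s kz[of "of_real s * cis t"] by (simp add: power_int_mult_distrib cis_power_int)
          moreover have "complex_of_real s powi n * of_real s powi (- n) = 1"
            using s by (simp add: power_int_minus)
          ultimately show ?thesis by (simp only: mult.assoc) (simp add: mult_ac)
        qed
        then show ?case by (simp only: integral_mult_right[symmetric])
      qed
    qed
  qed
  have g'c: "inverse (deriv g (cis t)) = of_real (inverse (circle_lift_deriv a t)) * cis (t - ?\<alpha> t)" for t
  proof -
    have "inverse (cis (?\<alpha> t - t)) = cis (t - ?\<alpha> t)" by simp
    then show ?thesis unfolding g_def lift(2) by (simp only: inverse_mult_distrib of_real_inverse)
  qed
  have Fi: "set_integrable lborel {0..2*pi} (F n)" for n
  proof -
    obtain C where C: "\<And>\<phi> :: complex \<Rightarrow> real. (\<lambda>t. \<phi> (cis t)) \<in> borel_measurable borel \<Longrightarrow> (\<And>z. 0 \<le> \<phi> z) \<Longrightarrow>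
      (\<integral>\<^sup>+t\<in>{0..2*pi}. ennreal (\<phi> (cis (?\<alpha> t))) \<partial>lborel) \<le> ennreal C * (\<integral>\<^sup>+t\<in>{0..2*pi}. ennreal (\<phi> (cis t)) \<partial>lborel)"
      using nn_integral_circle_reparam[OF lift(3,4) m lift(5)] by (elim exE conjE) auto
    have "?\<alpha> \<in> borel_measurable borel"
      by (intro borel_measurable_continuous_onI continuous_at_imp_continuous_on) (use lift(3) DERIV_isCont in blast)
    moreover have "continuous_on {0..2*pi} (\<lambda>t. inverse (deriv g (cis t)) * cis (- of_int n * t))"
      by (intro continuous_intros continuous_on_compose2[OF holomorphic_on_imp_continuous_on[OF g'hol]]) (use a in auto)
    ultimately show ?thesis
      unfolding F_def by (intro L2_circle_reparam_integrable[OF has_L2_extension_nn_integral(1,2)[OF XY] _ C]) auto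
  qed
  have sym: "A n = - cnj (A (2 - n))" for n
  proof -
    have Y: "Y \<in> borel_measurable circle_measure"
      using XY by (simp add: has_L2_extension_def L2_on_circle_def)
    have "AE t in lborel. indicator {0..2*pi} t *\<^sub>R F n t = - cnj (indicator {0..2*pi} t *\<^sub>R F (2 - n) t)"
      using AE_circle_reparam[OF tang Y lift(3,4) m lift(5)]
    proof eventually_elim
      case (elim t)
      show ?case
      proof (cases "t \<in> {0..2*pi}")
        case True
        define y where "y = Y (cis (?\<alpha> t))"
        define r where "r = complex_of_real (inverse (circle_lift_deriv a t))"
        have y: "y = - cis (2 * ?\<alpha> t) * cnj y" using elim True by (simp add: y_def)
        \<comment> \<open>Conjugation reverses the phase of the inverse derivative, from
          \<open>t - ?\<alpha> t\<close> to \<open>?\<alpha> t - t\<close>. The discrepancy is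
          \<open>cis (2 * ?\<alpha> t)\<close>, absorbed by the tangentiality of \<open>Y\<close>,
          and \<open>cis (- 2 * t)\<close>, absorbed by the 2 in the index.\<close>
        have "- cnj (F (2 - n) t) = - (cnj y * (r * (cis (?\<alpha> t - t) * cis ((2 - of_int n) * t))))"
          unfolding F_def g'c by (simp add: y_def r_def cis_cnj algebra_simps)
        also have "cis (?\<alpha> t - t) * cis ((2 - of_int n) * t) = cis (2 * ?\<alpha> t) * (cis (t - ?\<alpha> t) * cis (- of_int n * t))"
          by (simp add: cis_mult algebra_simps)
        also have "- (cnj y * (r * (cis (2 * ?\<alpha> t) * (cis (t - ?\<alpha> t) * cis (- of_int n * t))))) =
            (- cis (2 * ?\<alpha> t) * cnj y) * (r * (cis (t - ?\<alpha> t) * cis (- of_int n * t)))"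
          by (simp only: mult_ac mult_minus_left mult_minus_right)
        also have "\<dots> = F n t"
          unfolding y[symmetric] F_def g'c by (simp only: y_def r_def mult_ac)
        finally show ?thesis using True by simp
      qed simp
    qed
    moreover have Fm: "(\<lambda>t. indicator {0..2*pi} t *\<^sub>R F n t) \<in> borel_measurable lborel" for n
      using Fi[of n] unfolding set_integrable_def by (rule borel_measurable_integrable)
    ultimately have "A n = (LINT t|lborel. - cnj (indicator {0..2*pi} t *\<^sub>R F (2 - n) t))"
      unfolding A_def set_lebesgue_integral_def
      by (intro integral_cong_AE borel_measurable_uminus Fm measurable_compose[OF Fm] borel_measurable_continuous_onI continuous_intros)
    also have "\<dots> = - cnj (A (2 - n))"
      unfolding A_def set_lebesgue_integral_def by (simp only: Bochner_Integration.integral_minus Bochner_Integration.integral_cnj)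
    finally show ?thesis .
  qed
  show ?thesis using lim sym unfolding circle_coeff_def by blast
qed

section \<open>Differences of fields with the same quadratic differential\<close>

lemma dbar_from_lie_metric_20:
  assumes smooth: "smooth_on disc \<xi>" and lie: "\<forall>z\<in>disc. lie_metric_20 \<xi> z = f z" and z: "z \<in> disc"
  defines "D \<equiv> frechet_derivative \<xi> (at z)"
  shows "D 1 + \<i> * D \<i> = of_real ((1 - (cmod z)\<^sup>2)\<^sup>2 / 4) * cnj (f z)"
proof -
  have "(\<xi> has_derivative D) (at z)"
    unfolding D_def by (rule smooth_on_open_imp_deriv(1)[OF open_ball smooth z])
  then have "f z = of_real (4 / (1 - (cmod z)\<^sup>2)\<^sup>2) * cnj (D 1 + \<i> * D \<i>)"
    using lie_metric_20_eq[OF z] lie z by metis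
  then have "cnj (f z) = of_real (4 / (1 - (cmod z)\<^sup>2)\<^sup>2) * (D 1 + \<i> * D \<i>)"
    by (simp only: complex_cnj_mult complex_cnj_complex_of_real complex_cnj_cnj)
  moreover have "(1 - (cmod z)\<^sup>2)\<^sup>2 / 4 * (4 / (1 - (cmod z)\<^sup>2)\<^sup>2) = 1"
    using z norm_ge_zero[of z] by (auto simp: power2_eq_1_iff simp del: norm_ge_zero)
  then have "complex_of_real ((1 - (cmod z)\<^sup>2)\<^sup>2 / 4) * of_real (4 / (1 - (cmod z)\<^sup>2)\<^sup>2) = 1"
    by (metis of_real_mult of_real_1)
  ultimately show ?thesis by (simp only: mult.assoc[symmetric] mult_1_left)
qed

text \<open>The weight is the reciprocal of the squared hyperbolic length of the vector 1, so
  testing \<open>q\<close> on the pair (1, 1) turns its hyperbolic bound into a Euclidean bound on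
  d-bar.\<close>

lemma hyp_bounded_quad_diff:
  assumes "hyp_bounded 2 (quad_diff f)"
  obtains C where "\<And>z. z \<in> disc \<Longrightarrow> cmod (of_real ((1 - (cmod z)\<^sup>2)\<^sup>2 / 4) * cnj (f z)) \<le> C"
proof -
  obtain C where C: "\<And>z us. z \<in> disc \<Longrightarrow> length us = 2 \<Longrightarrow> cmod (quad_diff f z us) \<le> C * prod_list (map (hyp_norm z) us)"
    using assms unfolding hyp_bounded_def by blast
  have "cmod (of_real ((1 - (cmod z)\<^sup>2)\<^sup>2 / 4) * cnj (f z)) \<le> C" if z: "z \<in> disc" for z
  proof -
    let ?q = "(1 - (cmod z)\<^sup>2)\<^sup>2"
    have q: "?q > 0"
      using z norm_ge_zero[of z] by (auto simp: power2_eq_1_iff simp del: norm_ge_zero)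
    have "cmod (f z) \<le> C * (hyp_norm z 1 * hyp_norm z 1)"
      using C[OF z, of "[1, 1]"] by (simp add: quad_diff_def)
    also have "hyp_norm z 1 * hyp_norm z 1 = 4 / ?q"
      using q by (simp add: hyp_norm_def hyp_metric_def)
    finally have "?q / 4 * cmod (f z) \<le> C" using q by (simp add: field_simps)
    then show ?thesis using q by (simp only: norm_mult norm_of_real complex_mod_cnj abs_of_pos divide_pos_pos zero_less_numeral)
  qed
  then show ?thesis by (rule that)
qed

text \<open>Two fields and one Moebius function serve both claims of the theorem: equal fields give
  the values of the cocycle, the identity gives the difference of two admissible fields.\<close>

lemma pullback_difference_quadratic:
  fixes \<xi>\<^sub>1 \<xi>\<^sub>2 :: "complex \<Rightarrow> complex"
  assumes bdd: "hyp_bounded 2 (quad_diff f)"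
    and \<xi>1: "smooth_on disc \<xi>\<^sub>1" "\<forall>z\<in>disc. lie_metric_20 \<xi>\<^sub>1 z = f z" "has_tangential_L2_extension \<xi>\<^sub>1"
    and \<xi>2: "smooth_on disc \<xi>\<^sub>2" "\<forall>z\<in>disc. lie_metric_20 \<xi>\<^sub>2 z = f z" "has_tangential_L2_extension \<xi>\<^sub>2"
    and a: "cmod a < 1"
    and inv: "\<And>z. z \<in> disc \<Longrightarrow> f (Moebius_function \<theta> a z) * (deriv (Moebius_function \<theta> a) z)\<^sup>2 = f z"
  obtains c b where "Re b = 0"
    "\<And>z. z \<in> disc \<Longrightarrow> \<xi>\<^sub>2 (Moebius_function \<theta> a z) * inverse (deriv (Moebius_function \<theta> a) z) - \<xi>\<^sub>1 z = c + b * z - cnj c * z\<^sup>2"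
proof -
  define g where "g = Moebius_function \<theta> a"
  define \<eta> where "\<eta> = (\<lambda>z. \<xi>\<^sub>2 (g z) * inverse (deriv g z) - \<xi>\<^sub>1 z)"
  define D1 where "D1 z = frechet_derivative \<xi>\<^sub>1 (at z)" for z
  define D2 where "D2 z = frechet_derivative \<xi>\<^sub>2 (at z)" for z
  note der1 = smooth_on_open_imp_deriv(1)[OF open_ball \<xi>1(1), folded D1_def]
  note der2 = smooth_on_open_imp_deriv(1)[OF open_ball \<xi>2(1), folded D2_def]
  note cont1 = smooth_on_open_imp_deriv(2)[OF open_ball \<xi>1(1), folded D1_def]
  note cont2 = smooth_on_open_imp_deriv(2)[OF open_ball \<xi>2(1), folded D2_def]
  note dbar1 = dbar_from_lie_metric_20[OF \<xi>1(1,2), folded D1_def]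
  note dbar2 = dbar_from_lie_metric_20[OF \<xi>2(1,2), folded D2_def]
  obtain M where M: "\<And>z. z \<in> disc \<Longrightarrow> cmod (of_real ((1 - (cmod z)\<^sup>2)\<^sup>2 / 4) * cnj (f z)) \<le> M"
    using hyp_bounded_quad_diff[OF bdd] by blast
  obtain Y1 where Y1: "has_L2_extension \<xi>\<^sub>1 Y1" "tangential Y1"
    using \<xi>1(3) by (auto simp: has_tangential_L2_extension_def)
  obtain Y2 where Y2: "has_L2_extension \<xi>\<^sub>2 Y2" "tangential Y2"
    using \<xi>2(3) by (auto simp: has_tangential_L2_extension_def)
  have ghol: "g holomorphic_on disc" unfolding g_def by (rule Moebius_function_holomorphic[OF a])
  have gz: "g z \<in> disc" if "z \<in> disc" for z
    using Moebius_function_norm_lt_1[OF a] that by (auto simp: g_def)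
  have iso: "1 - (cmod (g z))\<^sup>2 = cmod (deriv g z) * (1 - (cmod z)\<^sup>2)" if "z \<in> disc" for z
    unfolding g_def by (rule Moebius_function_isometry[OF a]) (use that in auto)
  have g'0: "deriv g z \<noteq> 0" if "z \<in> disc" for z
  proof -
    have "(cmod (g z))\<^sup>2 < 1" using gz[OF that] by (simp add: power_less_one_iff)
    then show ?thesis using iso[OF that] by auto
  qed
  have g'hol: "(\<lambda>z. inverse (deriv g z)) holomorphic_on disc"
    by (intro holomorphic_intros holomorphic_deriv ghol) (use g'0 in auto)
  have \<eta>hol: "\<eta> holomorphic_on disc"
    unfolding holomorphic_on_open[OF open_ball]
  proof
    fix z assume z: "z \<in> disc"
    define q where "q = deriv g z"
    define p where "p = deriv (\<lambda>z. inverse (deriv g z)) z"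
    have q0: "q \<noteq> 0" using g'0[OF z] by (simp add: q_def)
    have dg: "(g has_derivative (\<lambda>v. q * v)) (at z)"
      using holomorphic_derivI[OF ghol open_ball z] by (simp add: has_field_derivative_def q_def)
    have dp: "((\<lambda>z. inverse (deriv g z)) has_derivative (\<lambda>v. p * v)) (at z)"
      using holomorphic_derivI[OF g'hol open_ball z] by (simp add: has_field_derivative_def p_def)
    define E where "E = (\<lambda>v. \<xi>\<^sub>2 (g z) * (p * v) + D2 (g z) (q * v) * inverse q - D1 z v)"
    have E: "(\<eta> has_derivative E) (at z)"
      unfolding \<eta>_def E_def q_def
      by (intro has_derivative_diff has_derivative_mult has_derivative_compose[OF dg[unfolded q_def] der2[OF gz[OF z]]] dp der1 z)
    have lin: "linear E" "linear (D2 (g z))"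
      using has_derivative_linear[OF E] has_derivative_linear[OF der2[OF gz[OF z]]] by auto
    have "E 1 + \<i> * E \<i> = (D2 (g z) q + \<i> * D2 (g z) (\<i> * q)) * inverse q - (D1 z 1 + \<i> * D1 z \<i>)"
      by (simp add: E_def algebra_simps)
    also have "\<dots> = cnj q * (of_real ((1 - (cmod (g z))\<^sup>2)\<^sup>2 / 4) * cnj (f (g z))) * inverse q
        - of_real ((1 - (cmod z)\<^sup>2)\<^sup>2 / 4) * cnj (f z)"
      by (simp only: dbar_rotate[OF lin(2)] dbar1[OF z] dbar2[OF gz[OF z]])
    also have "\<dots> = 0"
    proof -
      \<comment> \<open>Pulling back multiplies d-bar by \<open>cnj q / q\<close>. The weight
        contributes \<open>q * cnj q\<close>, and together these make
        \<open>(cnj q)\<^sup>2\<close>, the factor that invariance of \<open>f\<close>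
        requires.\<close>
      have 1: "complex_of_real ((1 - (cmod (g z))\<^sup>2)\<^sup>2 / 4) = q * cnj q * of_real ((1 - (cmod z)\<^sup>2)\<^sup>2 / 4)"
        unfolding iso[OF z] q_def[symmetric] complex_norm_square[symmetric]
        by (simp only: power_mult_distrib of_real_mult[symmetric] times_divide_eq_right)
      have 2: "cnj (f z) = cnj (f (g z)) * (cnj q)\<^sup>2"
        using inv[OF z] unfolding g_def[symmetric] q_def[symmetric] by (metis complex_cnj_mult complex_cnj_power)
      show ?thesis unfolding 1 2 using q0 by (simp add: power2_eq_square mult_ac)
    qed
    finally have "\<i> * E \<i> = - E 1" by (simp add: add_eq_0_iff)
    then have "E \<i> = \<i> * E 1" by (simp add: complex_eq_iff)
    then have "E v = E 1 * v" for v
      by (subst real_linear_complex_eq[OF lin(1)]) (simp add: complex_eq_iff algebra_simps)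
    then have "E = (\<lambda>v. E 1 * v)" by blast
    then have "(\<eta> has_field_derivative E 1) (at z)"
      using E unfolding has_field_derivative_def by metis
    then show "\<exists>f'. (\<eta> has_field_derivative f') (at z)" by blast
  qed
  have M1: "cmod (D1 z 1 + \<i> * D1 z \<i>) \<le> M" and M2: "cmod (D2 z 1 + \<i> * D2 z \<i>) \<le> M" if "z \<in> disc" for z
    unfolding dbar1[OF that] dbar2[OF that] using M[OF that] by auto
  \<comment> \<open>\<open>\<xi>\<^sub>1\<close> is treated as its own pullback by the identity, so
    one lemma supplies the limits of both sets of coefficients.\<close>
  have id: "Moebius_function 0 0 = (\<lambda>z. z)" by (simp add: Moebius_function_def fun_eq_iff)
  have "\<exists>A. (\<forall>n. (circle_coeff (\<lambda>z. \<xi>\<^sub>1 (Moebius_function 0 0 z) * inverse (deriv (Moebius_function 0 0) z)) n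
       \<longlongrightarrow> A n) (at_left 1)) \<and> (\<forall>n. A n = - cnj (A (2 - n)))"
    by (rule pullback_fourier_coeffs[OF der1 cont1 M1 Y1]) simp_all
  then obtain A1 where A1: "\<And>n. (circle_coeff \<xi>\<^sub>1 n \<longlongrightarrow> A1 n) (at_left 1)" "\<And>n. A1 n = - cnj (A1 (2 - n))"
    unfolding id deriv_ident inverse_1 mult_1_right by (elim exE conjE) (rule that, (erule spec)+)
  have "\<exists>A. (\<forall>n. (circle_coeff (\<lambda>z. \<xi>\<^sub>2 (g z) * inverse (deriv g z)) n \<longlongrightarrow> A n) (at_left 1)) \<and>
      (\<forall>n. A n = - cnj (A (2 - n)))"
    unfolding g_def by (rule pullback_fourier_coeffs[OF der2 cont2 M2 Y2 a])
  then obtain A2 where A2: "\<And>n. (circle_coeff (\<lambda>z. \<xi>\<^sub>2 (g z) * inverse (deriv g z)) n \<longlongrightarrow> A2 n) (at_left 1)"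
    "\<And>n. A2 n = - cnj (A2 (2 - n))"
    by (elim exE conjE) (rule that, (erule spec)+)
  have c1: "continuous_on disc \<xi>\<^sub>1" and c2: "continuous_on disc \<xi>\<^sub>2"
    using der1 der2 by (auto intro!: continuous_at_imp_continuous_on has_derivative_continuous)
  have c3: "continuous_on disc (\<lambda>z. \<xi>\<^sub>2 (g z) * inverse (deriv g z))"
    by (intro continuous_intros continuous_on_compose2[OF c2 holomorphic_on_imp_continuous_on[OF ghol]]
         holomorphic_on_imp_continuous_on[OF g'hol]) (use gz in auto)
  have "(circle_coeff \<eta> n \<longlongrightarrow> A2 n - A1 n) (at_left 1)" for n
  proof (rule Lim_transform_eventually[OF tendsto_diff[OF A2(1) A1(1)]])
    show "\<forall>\<^sub>F s in at_left 1. circle_coeff (\<lambda>z. \<xi>\<^sub>2 (g z) * inverse (deriv g z)) n s - circle_coeff \<xi>\<^sub>1 n s = circle_coeff \<eta> n s"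
      using eventually_at_left_real[of 0 1, simplified]
    proof eventually_elim
      case (elim s)
      have int: "(\<lambda>t. h (of_real s * cis t) * cis (- of_int n * t)) integrable_on {0..2*pi}"
        if "continuous_on disc h" for h
        by (intro integrable_continuous_real continuous_intros continuous_on_compose2[OF that])
           (use elim in \<open>auto simp: norm_mult\<close>)
      show ?case
        unfolding \<eta>_def circle_coeff_def by (subst Henstock_Kurzweil_Integration.integral_diff[OF int[OF c3] int[OF c1], symmetric])
          (simp add: algebra_simps)
    qed
  qed
  moreover have "A2 n - A1 n = - cnj (A2 (2 - n) - A1 (2 - n))" for n
    using A1(2)[of n] A2(2)[of n] by simp
  ultimately show ?thesis
    by (rule holomorphic_tangential_quadratic[OF \<eta>hol, of "\<lambda>n. A2 n - A1 n"])
       (rule that, simp_all add: \<eta>_def g_def)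
qed

section \<open>Cocycles\<close>

lemma quadratic_killing_field:
  assumes "Re b = 0" "\<And>z. z \<in> disc \<Longrightarrow> \<eta> z = c + b * z - cnj c * z\<^sup>2" "\<eta> \<in> extensional disc"
  shows "\<eta> \<in> killing_fields"
proof -
  have "smooth_on disc \<eta>"
    unfolding smooth_on_def
  proof
    fix p :: complex assume "p \<in> disc"
    have "\<forall>k. Ck_on k UNIV (\<lambda>z. c + b * z - cnj c * z\<^sup>2)"
      by (intro allI holomorphic_imp_Ck_on holomorphic_intros) auto
    then show "\<exists>W F. open W \<and> p \<in> W \<and> (\<forall>k. Ck_on k W F) \<and> (\<forall>x\<in>disc \<inter> W. F x = \<eta> x)"
      using assms(2) by (intro exI[of _ UNIV] exI[of _ "\<lambda>z. c + b * z - cnj c * z\<^sup>2"]) auto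
  qed
  then show ?thesis
    using assms quadratic_lie_metric unfolding killing_fields_def by blast
qed

lemma deriv_isom_plus_compose:
  assumes "\<gamma>\<^sub>1 \<in> carrier isom_plus" "\<gamma>\<^sub>2 \<in> carrier isom_plus" "z \<in> disc"
  shows "deriv (compose disc \<gamma>\<^sub>1 \<gamma>\<^sub>2) z = deriv \<gamma>\<^sub>1 (\<gamma>\<^sub>2 z) * deriv \<gamma>\<^sub>2 z"
proof -
  have "\<gamma>\<^sub>2 z \<in> disc" using isom_plus_holomorphic(2)[OF assms(2)] assms(3) by blast
  then have "((\<gamma>\<^sub>1 \<circ> \<gamma>\<^sub>2) has_field_derivative deriv \<gamma>\<^sub>1 (\<gamma>\<^sub>2 z) * deriv \<gamma>\<^sub>2 z) (at z)"
    by (intro DERIV_chain holomorphic_derivI[OF isom_plus_holomorphic(1)] assms) auto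
  then have "(compose disc \<gamma>\<^sub>1 \<gamma>\<^sub>2 has_field_derivative deriv \<gamma>\<^sub>1 (\<gamma>\<^sub>2 z) * deriv \<gamma>\<^sub>2 z) (at z)"
    by (rule has_field_derivative_transform_within_open[where S = disc]) (use assms in \<open>auto simp: compose_def\<close>)
  then show ?thesis by (rule DERIV_imp_deriv)
qed

text \<open>\<open>\<xi>\<close> need not lie in \<open>M\<close>: the cocycle identity is the chain
  rule and holds for any field, so only the values have to be placed in \<open>M\<close>.\<close>

lemma coboundary_cocycle:
  assumes \<Gamma>: "subgroup \<Gamma> isom_plus"
    and "\<And>\<gamma>. \<gamma> \<in> \<Gamma> \<Longrightarrow> coboundary \<Gamma> \<xi> \<gamma> \<in> M"
  shows "coboundary \<Gamma> \<xi> \<in> cocycles \<Gamma> M"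
  unfolding cocycles_def
proof (intro CollectI conjI ballI PiE_I)
  fix \<gamma>\<^sub>1 \<gamma>\<^sub>2 assume \<gamma>: "\<gamma>\<^sub>1 \<in> \<Gamma>" "\<gamma>\<^sub>2 \<in> \<Gamma>"
  have carr: "\<gamma>\<^sub>1 \<in> carrier isom_plus" "\<gamma>\<^sub>2 \<in> carrier isom_plus"
    using \<gamma> subgroup.mem_carrier[OF \<Gamma>] by auto
  have "\<gamma>\<^sub>1 \<otimes>\<^bsub>isom_plus\<^esub> \<gamma>\<^sub>2 \<in> \<Gamma>" by (rule subgroup.m_closed[OF \<Gamma> \<gamma>])
  then have comp: "compose disc \<gamma>\<^sub>1 \<gamma>\<^sub>2 \<in> \<Gamma>"
    using carr by (auto simp: isom_plus_def BijGroup_def)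
  have im: "\<gamma>\<^sub>2 z \<in> disc" if "z \<in> disc" for z
    using isom_plus_holomorphic(2)[OF carr(2)] that by blast
  show "coboundary \<Gamma> \<xi> (compose disc \<gamma>\<^sub>1 \<gamma>\<^sub>2) =
     (\<lambda>z\<in>disc. pullback \<gamma>\<^sub>2 (coboundary \<Gamma> \<xi> \<gamma>\<^sub>1) z + coboundary \<Gamma> \<xi> \<gamma>\<^sub>2 z)"
  proof
    fix z
    show "coboundary \<Gamma> \<xi> (compose disc \<gamma>\<^sub>1 \<gamma>\<^sub>2) z =
     (\<lambda>z\<in>disc. pullback \<gamma>\<^sub>2 (coboundary \<Gamma> \<xi> \<gamma>\<^sub>1) z + coboundary \<Gamma> \<xi> \<gamma>\<^sub>2 z) z"
    proof (cases "z \<in> disc")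
      case True
      note d = deriv_isom_plus_compose[OF carr True]
      have "compose disc \<gamma>\<^sub>1 \<gamma>\<^sub>2 z = \<gamma>\<^sub>1 (\<gamma>\<^sub>2 z)" using True by (simp add: compose_def)
      then show ?thesis
        using True im[OF True] comp \<gamma> by (simp add: coboundary_def pullback_def d algebra_simps del: mem_ball)
    qed (use comp in \<open>simp add: coboundary_def\<close>)
  qed
qed (use assms in \<open>auto simp: coboundary_def\<close>)

text \<open>Equality of the two images is transitivity of \<open>cohomologous\<close> in both
  directions; the new witnesses are the sum and the difference of the old ones.\<close>

lemma cohomology_class_eqI:
  assumes c: "c \<in> cocycles \<Gamma> M" "c' \<in> cocycles \<Gamma> M" and m: "m \<in> M"
    and diff: "\<And>\<gamma> z. \<gamma> \<in> \<Gamma> \<Longrightarrow> z \<in> disc \<Longrightarrow> c' \<gamma> z - c \<gamma> z = coboundary \<Gamma> m \<gamma> z"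
    and sub: "\<And>m m'. m \<in> M \<Longrightarrow> m' \<in> M \<Longrightarrow> (\<lambda>z\<in>disc. m z - m' z) \<in> M"
    and add: "\<And>m m'. m \<in> M \<Longrightarrow> m' \<in> M \<Longrightarrow> (\<lambda>z\<in>disc. m z + m' z) \<in> M"
    and im: "\<And>\<gamma> z. \<gamma> \<in> \<Gamma> \<Longrightarrow> z \<in> disc \<Longrightarrow> \<gamma> z \<in> disc"
  shows "cohomology_class \<Gamma> M c' = cohomology_class \<Gamma> M c"
proof -
  have cob: "coboundary \<Gamma> (\<lambda>z\<in>disc. m z - m' z) \<gamma> z = coboundary \<Gamma> m \<gamma> z - coboundary \<Gamma> m' \<gamma> z"
    "coboundary \<Gamma> (\<lambda>z\<in>disc. m z + m' z) \<gamma> z = coboundary \<Gamma> m \<gamma> z + coboundary \<Gamma> m' \<gamma> z"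
    if "\<gamma> \<in> \<Gamma>" "z \<in> disc" for \<gamma> z and m m' :: "complex \<Rightarrow> complex"
    using that im[OF that] by (auto simp: coboundary_def pullback_def algebra_simps)
  have "(c', d) \<in> cohomologous \<Gamma> M \<longleftrightarrow> (c, d) \<in> cohomologous \<Gamma> M" for d
  proof
    assume "(c', d) \<in> cohomologous \<Gamma> M"
    then obtain m' where d: "d \<in> cocycles \<Gamma> M" "m' \<in> M"
      "\<And>\<gamma> z. \<gamma> \<in> \<Gamma> \<Longrightarrow> z \<in> disc \<Longrightarrow> d \<gamma> z - c' \<gamma> z = coboundary \<Gamma> m' \<gamma> z"
      unfolding cohomologous_def by blast
    have "d \<gamma> z - c \<gamma> z = coboundary \<Gamma> (\<lambda>z\<in>disc. m z + m' z) \<gamma> z" if "\<gamma> \<in> \<Gamma>" "z \<in> disc" for \<gamma> z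
      unfolding cob[OF that] using d(3)[OF that] diff[OF that] by (simp add: algebra_simps)
    then show "(c, d) \<in> cohomologous \<Gamma> M"
      unfolding cohomologous_def using c d(1) add[OF m d(2)] by blast
  next
    assume "(c, d) \<in> cohomologous \<Gamma> M"
    then obtain m' where d: "d \<in> cocycles \<Gamma> M" "m' \<in> M"
      "\<And>\<gamma> z. \<gamma> \<in> \<Gamma> \<Longrightarrow> z \<in> disc \<Longrightarrow> d \<gamma> z - c \<gamma> z = coboundary \<Gamma> m' \<gamma> z"
      unfolding cohomologous_def by blast
    have "d \<gamma> z - c' \<gamma> z = coboundary \<Gamma> (\<lambda>z\<in>disc. m' z - m z) \<gamma> z" if "\<gamma> \<in> \<Gamma>" "z \<in> disc" for \<gamma> z
      unfolding cob[OF that] using d(3)[OF that] diff[OF that] by (simp add: algebra_simps)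
    then show "(c', d) \<in> cohomologous \<Gamma> M"
      unfolding cohomologous_def using c d(1) sub[OF d(2) m] by blast
  qed
  then show ?thesis
    unfolding cohomology_class_def by blast
qed

lemma coboundary_killing:
  assumes \<Gamma>: "subgroup \<Gamma> isom_plus" and \<gamma>: "\<gamma> \<in> \<Gamma>"
    and bdd: "hyp_bounded 2 (quad_diff f)"
    and \<xi>: "smooth_on disc \<xi>" "\<forall>z\<in>disc. lie_metric_20 \<xi> z = f z" "has_tangential_L2_extension \<xi>"
    and inv: "\<forall>\<gamma>\<in>\<Gamma>. \<forall>z\<in>disc. f (\<gamma> z) * (deriv \<gamma> z)\<^sup>2 = f z"
  shows "coboundary \<Gamma> \<xi> \<gamma> \<in> killing_fields"
proof -
  have "\<gamma> \<in> carrier isom_plus" using subgroup.mem_carrier[OF \<Gamma> \<gamma>] .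
  then obtain \<theta> a where a: "cmod a < 1" and g: "\<And>z. z \<in> disc \<Longrightarrow> \<gamma> z = Moebius_function \<theta> a z"
    by (rule isom_plus_Moebius) (rule that, assumption, blast)
  \<comment> \<open>\<open>\<gamma>\<close> and the Moebius function are known to agree on the disc
    only, but the disc is open.\<close>
  have d: "deriv \<gamma> z = deriv (Moebius_function \<theta> a) z" if "z \<in> disc" for z
    by (rule deriv_cong_ev) (use g that in \<open>auto intro!: eventually_nhds_in_open[THEN eventually_mono, of disc]\<close>)
  have inv': "f (Moebius_function \<theta> a z) * (deriv (Moebius_function \<theta> a) z)\<^sup>2 = f z" if "z \<in> disc" for z
    using inv \<gamma> that g[OF that] d[OF that] by metis
  obtain c b where "Re b = 0" "\<And>z. z \<in> disc \<Longrightarrow>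
      \<xi> (Moebius_function \<theta> a z) * inverse (deriv (Moebius_function \<theta> a) z) - \<xi> z = c + b * z - cnj c * z\<^sup>2"
    by (rule pullback_difference_quadratic[OF bdd \<xi> \<xi> a inv']) (assumption, rule that, assumption, blast)
  then show ?thesis
    by (intro quadratic_killing_field[of b _ c])
       (auto simp: coboundary_def pullback_def \<gamma> g d simp del: mem_ball)
qed

theorem corollary1:
  fixes \<Gamma> :: "(complex \<Rightarrow> complex) set" and f \<xi> :: "complex \<Rightarrow> complex"
  assumes "subgroup \<Gamma> isom_plus"
    and "f holomorphic_on disc"
    and "hyp_bounded 2 (quad_diff f)"
    and "hyp_bounded 3 (cov_deriv (quad_diff f))"
    and "hyp_bounded 4 (cov_deriv (cov_deriv (quad_diff f)))"
    and "harmonic_vector_field disc \<xi>"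
    and "\<forall>z\<in>disc. lie_metric_20 \<xi> z = f z"
    and "has_tangential_L2_extension \<xi>"
    and "\<forall>\<gamma>\<in>\<Gamma>. \<forall>z\<in>disc. f (\<gamma> z) * (deriv \<gamma> z)\<^sup>2 = f z"
  shows "coboundary \<Gamma> \<xi> \<in> cocycles \<Gamma> killing_fields \<and>
    (\<forall>\<xi>'. harmonic_vector_field disc \<xi>' \<and> (\<forall>z\<in>disc. lie_metric_20 \<xi>' z = f z) \<and>
           has_tangential_L2_extension \<xi>' \<longrightarrow>
         cohomology_class \<Gamma> killing_fields (coboundary \<Gamma> \<xi>') =
         cohomology_class \<Gamma> killing_fields (coboundary \<Gamma> \<xi>))"
proof (intro conjI allI impI)
  have cocycle: "coboundary \<Gamma> \<zeta> \<in> cocycles \<Gamma> killing_fields"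
    if "harmonic_vector_field disc \<zeta>" "\<forall>z\<in>disc. lie_metric_20 \<zeta> z = f z" "has_tangential_L2_extension \<zeta>" for \<zeta>
    using that assms(1,3,9)
    by (intro coboundary_cocycle coboundary_killing[where f = f]) (auto simp: harmonic_vector_field_def)
  show c: "coboundary \<Gamma> \<xi> \<in> cocycles \<Gamma> killing_fields"
    by (rule cocycle[OF assms(6-8)])
  fix \<xi>' assume \<xi>': "harmonic_vector_field disc \<xi>' \<and> (\<forall>z\<in>disc. lie_metric_20 \<xi>' z = f z) \<and>
           has_tangential_L2_extension \<xi>'"
  have c': "coboundary \<Gamma> \<xi>' \<in> cocycles \<Gamma> killing_fields"
    using cocycle \<xi>' by blast
  have smooth: "smooth_on disc \<xi>" "smooth_on disc \<xi>'"
    using assms(6) \<xi>' by (auto simp: harmonic_vector_field_def)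
  have id: "Moebius_function 0 0 = (\<lambda>z. z)" by (simp add: Moebius_function_def fun_eq_iff)
  \<comment> \<open>Zero parameters give the identity, for which invariance of \<open>f\<close> is
    trivial.\<close>
  obtain e b where "Re b = 0" "\<And>z. z \<in> disc \<Longrightarrow>
      \<xi>' (Moebius_function 0 0 z) * inverse (deriv (Moebius_function 0 0) z) - \<xi> z = e + b * z - cnj e * z\<^sup>2"
    by (rule pullback_difference_quadratic[OF assms(3) smooth(1) assms(7,8) smooth(2), of 0 0])
       (use \<xi>' in \<open>simp_all add: id\<close>)
  then have m: "(\<lambda>z\<in>disc. \<xi>' z - \<xi> z) \<in> killing_fields"
    by (intro quadratic_killing_field[of b _ e]) (simp_all add: id)
  have im: "\<gamma> z \<in> disc" if "\<gamma> \<in> \<Gamma>" "z \<in> disc" for \<gamma> z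
    using isom_plus_holomorphic(2)[OF subgroup.mem_carrier[OF assms(1) that(1)]] that(2) by blast
  show "cohomology_class \<Gamma> killing_fields (coboundary \<Gamma> \<xi>') = cohomology_class \<Gamma> killing_fields (coboundary \<Gamma> \<xi>)"
  proof (rule cohomology_class_eqI[OF c c' m])
    show "coboundary \<Gamma> \<xi>' \<gamma> z - coboundary \<Gamma> \<xi> \<gamma> z = coboundary \<Gamma> (\<lambda>z\<in>disc. \<xi>' z - \<xi> z) \<gamma> z"
      if "\<gamma> \<in> \<Gamma>" "z \<in> disc" for \<gamma> z
      using that im[OF that] by (simp add: coboundary_def pullback_def algebra_simps del: mem_ball)
    show "(\<lambda>z\<in>disc. m z - m' z) \<in> killing_fields" "(\<lambda>z\<in>disc. m z + m' z) \<in> killing_fields"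
      if "m \<in> killing_fields" "m' \<in> killing_fields" for m m'
      using killing_fields_add_scaleR[OF that, of "- 1"] killing_fields_add_scaleR[OF that, of 1] by simp_all
  qed (rule im)
qed

end
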